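(* Let $n\ge 1$, let $Q$ be a complete quaternionic $C_n$-universe, and let $\mathcal{W}=\{W_k\}_{k\ge 0}$ be the split full flag on $Q$ with $W_k=\Psi_k$ for all $k\geq 0$, so that $\mathcal{W}_k=\bigoplus_{i=0}^{k-1}\Psi_i$. Then the $\mathcal{W}$-filtration $$\mathrm{pt}=\mathrm{P}_{\mathbb{H}}(\mathcal{W}_1)\subseteq\mathrm{P}_{\mathbb{H}}(\mathcal{W}_2)\subseteq\cdots\subseteq\mathrm{P}_{\mathbb{H}}(Q)$$ of $\mathrm{P}_{\mathbb{H}}(Q)$ is a properly even $C_n$-cell complex structure.
   Context: Representations. A quaternionic $C_n$-representation is a left $\mathbb{H}$-module with $C_n$ acting by left $\mathbb{H}$-linear maps. Let $\mathbf{1}_n$ be the usual generator of $C_n$ and $\zeta_n=e^{2\pi i/n}$. For an integer $r$, $\Psi_r$ is $\mathbb{H}$ with $\mathbf{1}_n\cdot q=q\zeta_n^r$ (every irreducible quaternionic $C_n$-representation is isomorphic to some $\Psi_r$). A complete quaternionic $C_n$-universe is a direct sum of countably infinitely many copies of each irreducible quaternionic $C_n$-representation. A split full flag of a countable-dimensional quaternionic representation $W$ is a collection $\mathcal{U}=\{U_k\}_{k\ge0}$ of irreducible quaternionic subrepresentations with $W=\bigoplus_{k\ge0}U_k$; one writes $\mathcal{U}_k=\bigoplus_{i=0}^{k-1}U_i$. "$W_k=\Psi_k$" means a chosen subrepresentation isomorphic to $\Psi_k$. Projective space. $\mathrm{P}_{\mathbb{H}}(W)=(W\setminus\{0\})/{\sim}$,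 $w\sim\lambda w$ for $\lambda\in\mathbb{H}^\times$, with the quotient topology (Euclidean topology on finite-dimensional modules, colimit topology in the countable-dimensional case) and action $g\langle w\rangle=\langle gw\rangle$. Cell complexes. For a real representation $V$ of a finite group, with an invariant inner product, $\mathbf{D}(V)$ and $\mathbf{S}(V)$ are its unit disk and unit sphere, and $|V|$ is its real dimension. A $G$-cell complex is a $G$-space $X$ with an increasing filtration by sub-$G$-spaces $X_m$ such that $X_0$ is a discrete $G$-set; $X_{m+1}$ is formed from $X_m$ by attaching cells $G\times_K\mathbf{D}(V)$ along $G$-maps $G\times_K\mathbf{S}(V)\to X_m$, where $K\le G$ is a subgroup and $V$ a real $K$-representation (both may vary with the cell); and $X$ is the colimit of the $X_m$. For representations $W,V$ of a group, $W\ll V$ means: whenever $|W^S|<|V^S|$ for a subgroup $S$, then $|W^T|\le|V^T|$ for all subgroups $T\ge S$. A $G$-cell complex structure is properly even if: (a) every cell $G\times_H\mathbf{D}(V)$ is even, i.e. $|V^K|$ is even for all subgroups $K\le H$; (b) if the cell $G\times_H\mathbf{D}(W)$ is attached before the cell $G\times_H\mathbf{D}(V)$, then $W\ll V$; (c) for any positive integer $N$ there are only finitely many cells $G\times_H\mathbf{D}(V)$ with $|V^K|\le N$ for all subgroups $K$; (d) each piece $X_m$ of the filtration is a finite $G$-cell complex. *)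

theory Defs
  imports "HOL-Analysis.Analysis" "HOL-Analysis.Finite_Function_Topology" "HOL-Algebra.Elementary_Groups"
begin

section \<open>Quaternions\<close>

text \<open>\<^term>\<open>Quat a b\<close> stands for \<open>a + b j\<close> with complex \<open>a\<close>, \<open>b\<close>; multiplication is determined
  by \<open>j j = - 1\<close> and \<open>j z = cnj z j\<close>.\<close>

datatype quat = Quat (qfst: complex) (qsnd: complex)

lemma quat_eq_iff: "p = q \<longleftrightarrow> qfst p = qfst q \<and> qsnd p = qsnd q"
  by (cases p; cases q) auto

instantiation quat :: real_normed_div_algebra
begin

definition "0 = Quat 0 0"
definition "1 = Quat 1 0"
definition "p + q = Quat (qfst p + qfst q) (qsnd p + qsnd q)"
definition "- p = Quat (- qfst p) (- qsnd p)"
definition "p - q = Quat (qfst p - qfst q) (qsnd p - qsnd q)"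
definition "p * q = Quat (qfst p * qfst q - qsnd p * cnj (qsnd q))
                         (qfst p * qsnd q + qsnd p * cnj (qfst q))"
definition "scaleR r p = Quat (r *\<^sub>R qfst p) (r *\<^sub>R qsnd p)"
definition norm_quat :: "quat \<Rightarrow> real" where
  "norm_quat p = sqrt ((cmod (qfst p))\<^sup>2 + (cmod (qsnd p))\<^sup>2)"
definition inverse_quat :: "quat \<Rightarrow> quat" where
  "inverse_quat p = inverse ((norm p)\<^sup>2) *\<^sub>R Quat (cnj (qfst p)) (- qsnd p)"
definition divide_quat :: "quat \<Rightarrow> quat \<Rightarrow> quat" where
  "divide_quat p q = p * inverse q"
definition sgn_quat :: "quat \<Rightarrow> quat" where
  "sgn_quat p = inverse (norm p) *\<^sub>R p"
definition dist_quat :: "quat \<Rightarrow> quat \<Rightarrow> real" where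
  "dist_quat p q = norm (p - q)"
definition uniformity_quat :: "(quat \<times> quat) filter" where
  "uniformity_quat = (INF e\<in>{0<..}. principal {(p, q). dist p q < e})"
definition open_quat :: "quat set \<Rightarrow> bool" where
  "open_quat U \<longleftrightarrow> (\<forall>x\<in>U. \<forall>\<^sub>F (x', y) in uniformity. x' = x \<longrightarrow> y \<in> U)"

lemmas quat_simps = zero_quat_def one_quat_def plus_quat_def uminus_quat_def minus_quat_def
  times_quat_def scaleR_quat_def

lemma quat_norm_Pair: "norm p = norm (qfst p, qsnd p)"
  by (simp add: norm_quat_def norm_prod_def)

lemma quat_norm_mult: "norm (p * q) = norm p * norm (q::quat)"
proof -
  have "(cmod (a * c - b * cnj d))\<^sup>2 + (cmod (a * d + b * cnj c))\<^sup>2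
      = ((cmod a)\<^sup>2 + (cmod b)\<^sup>2) * ((cmod c)\<^sup>2 + (cmod d)\<^sup>2)" for a b c d
    unfolding cmod_power2 by (simp add: power2_eq_square algebra_simps)
  then show ?thesis
    by (simp add: norm_quat_def times_quat_def flip: real_sqrt_mult)
qed

lemma quat_norm_sq: "complex_of_real ((norm p)\<^sup>2) = qfst p * cnj (qfst p) + qsnd p * cnj (qsnd p)"
  by (simp add: norm_quat_def complex_norm_square del: of_real_power)

lemma quat_norm_eq_0: "norm p = 0 \<longleftrightarrow> p = (0::quat)"
  by (simp add: norm_quat_def zero_quat_def quat_eq_iff add_nonneg_eq_0_iff)

lemma quat_inverse:
  assumes "p \<noteq> (0::quat)"
  shows "inverse p * p = 1" "p * inverse p = 1"
proof -
  have "(norm p)\<^sup>2 \<noteq> 0" using assms quat_norm_eq_0 by auto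
  then have "inverse (complex_of_real ((norm p)\<^sup>2)) * (qfst p * cnj (qfst p) + qsnd p * cnj (qsnd p)) = 1"
    unfolding quat_norm_sq[symmetric] by (simp flip: of_real_mult of_real_inverse)
  then show "inverse p * p = 1" "p * inverse p = 1"
    by (simp_all add: inverse_quat_def quat_simps quat_eq_iff scaleR_conv_of_real algebra_simps)
qed

instance
proof
  fix p q :: quat and r :: real
  show "norm (p + q) \<le> norm p + norm q"
    using norm_triangle_ineq[of "(qfst p, qsnd p)" "(qfst q, qsnd q)"]
    by (simp add: quat_norm_Pair plus_quat_def)
  show "norm (r *\<^sub>R p) = \<bar>r\<bar> * norm p"
    using norm_scaleR[of r "(qfst p, qsnd p)"] by (simp add: quat_norm_Pair scaleR_quat_def)
  show "norm p = 0 \<longleftrightarrow> p = 0" "norm (p * q) = norm p * norm q"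
    by (fact quat_norm_eq_0 quat_norm_mult)+
  show "inverse (0::quat) = 0"
    by (simp add: inverse_quat_def quat_simps)
  show "p \<noteq> 0 \<Longrightarrow> inverse p * p = 1" "p \<noteq> 0 \<Longrightarrow> p * inverse p = 1"
    by (fact quat_inverse)+
qed (rule divide_quat_def sgn_quat_def dist_quat_def uniformity_quat_def open_quat_def |
     force simp: quat_simps quat_eq_iff algebra_simps)+

end

definition quat_of_complex :: "complex \<Rightarrow> quat" where
  "quat_of_complex z = Quat z 0"


section \<open>Quaternionic representations\<close>

text \<open>Modules and representations live on subsets \<open>W\<close> of an ambient abelian group type;
  \<open>smul\<close> is left scalar multiplication and \<open>act\<close> the group action.\<close>

definition left_module :: "(quat \<Rightarrow> 'q \<Rightarrow> 'q) \<Rightarrow> 'q::ab_group_add set \<Rightarrow> bool" where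
  "left_module smul W \<longleftrightarrow>
     0 \<in> W \<and> (\<forall>x\<in>W. \<forall>y\<in>W. x + y \<in> W) \<and> (\<forall>a. \<forall>x\<in>W. smul a x \<in> W) \<and>
     (\<forall>a. \<forall>x\<in>W. \<forall>y\<in>W. smul a (x + y) = smul a x + smul a y) \<and>
     (\<forall>a b. \<forall>x\<in>W. smul (a + b) x = smul a x + smul b x) \<and>
     (\<forall>a b. \<forall>x\<in>W. smul (a * b) x = smul a (smul b x)) \<and>
     (\<forall>x\<in>W. smul 1 x = x)"

definition quat_rep ::
  "'g monoid \<Rightarrow> (quat \<Rightarrow> 'q \<Rightarrow> 'q) \<Rightarrow> ('g \<Rightarrow> 'q \<Rightarrow> 'q) \<Rightarrow> 'q::ab_group_add set \<Rightarrow> bool" where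
  "quat_rep G smul act W \<longleftrightarrow>
     left_module smul W \<and>
     (\<forall>g\<in>carrier G. \<forall>x\<in>W. act g x \<in> W) \<and>
     (\<forall>g\<in>carrier G. \<forall>x\<in>W. \<forall>y\<in>W. act g (x + y) = act g x + act g y) \<and>
     (\<forall>g\<in>carrier G. \<forall>a. \<forall>x\<in>W. act g (smul a x) = smul a (act g x)) \<and>
     (\<forall>x\<in>W. act \<one>\<^bsub>G\<^esub> x = x) \<and>
     (\<forall>g\<in>carrier G. \<forall>h\<in>carrier G. \<forall>x\<in>W. act (g \<otimes>\<^bsub>G\<^esub> h) x = act g (act h x))"

definition irreducible_rep ::
  "'g monoid \<Rightarrow> (quat \<Rightarrow> 'q \<Rightarrow> 'q) \<Rightarrow> ('g \<Rightarrow> 'q \<Rightarrow> 'q) \<Rightarrow> 'q::ab_group_add set \<Rightarrow> bool" where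
  "irreducible_rep G smul act U \<longleftrightarrow>
     quat_rep G smul act U \<and> U \<noteq> {0} \<and>
     (\<forall>S. S \<subseteq> U \<and> quat_rep G smul act S \<longrightarrow> S = {0} \<or> S = U)"

definition rep_iso ::
  "'g monoid \<Rightarrow> (quat \<Rightarrow> 'a \<Rightarrow> 'a) \<Rightarrow> ('g \<Rightarrow> 'a \<Rightarrow> 'a) \<Rightarrow> 'a::ab_group_add set \<Rightarrow>
   (quat \<Rightarrow> 'b \<Rightarrow> 'b) \<Rightarrow> ('g \<Rightarrow> 'b \<Rightarrow> 'b) \<Rightarrow> 'b::ab_group_add set \<Rightarrow> bool" where
  "rep_iso G smul1 act1 U1 smul2 act2 U2 \<longleftrightarrow>
     (\<exists>f. bij_betw f U1 U2 \<and>
          (\<forall>x\<in>U1. \<forall>y\<in>U1. f (x + y) = f x + f y) \<and>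
          (\<forall>a. \<forall>x\<in>U1. f (smul1 a x) = smul2 a (f x)) \<and>
          (\<forall>g\<in>carrier G. \<forall>x\<in>U1. f (act1 g x) = act2 g (f x)))"

text \<open>The action of the group element \<open>a\<close> of \<^term>\<open>integer_mod_group n\<close> on \<open>\<Psi>\<^sub>r\<close>; the generator
  acts by right multiplication with the \<open>r\<close>-th power of \<open>\<zeta> = exp (2 \<pi> i / n)\<close>.\<close>

definition Psi_act :: "nat \<Rightarrow> int \<Rightarrow> int \<Rightarrow> quat \<Rightarrow> quat" where
  "Psi_act n r a q = q * quat_of_complex (cis (2 * pi / real n) powi (r * a))"

definition iso_Psi ::
  "nat \<Rightarrow> (quat \<Rightarrow> 'q \<Rightarrow> 'q) \<Rightarrow> (int \<Rightarrow> 'q \<Rightarrow> 'q) \<Rightarrow> int \<Rightarrow> 'q::ab_group_add set \<Rightarrow> bool" where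
  "iso_Psi n smul act r U \<longleftrightarrow>
     rep_iso (integer_mod_group n) smul act U (*) (Psi_act n r) UNIV"

definition direct_sum :: "(nat \<Rightarrow> 'q set) \<Rightarrow> 'q::ab_group_add set \<Rightarrow> bool" where
  "direct_sum U W \<longleftrightarrow>
     (\<forall>k. U k \<subseteq> W) \<and>
     (\<forall>w\<in>W. \<exists>!f. (\<forall>k. f k \<in> U k) \<and> finite {k. f k \<noteq> 0} \<and> w = (\<Sum>k | f k \<noteq> 0. f k))"

text \<open>Every irreducible quaternionic representation of the cyclic group is isomorphic to some
  \<open>\<Psi>\<^sub>r\<close>, and \<open>\<Psi>\<^sub>r\<close> may be isomorphic to \<open>\<Psi>\<^sub>s\<close> for \<open>r \<noteq> s\<close>; so multiplicities are counted up to
  isomorphism: each isomorphism type occurs for infinitely many of the countably many summands.\<close>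

definition complete_universe ::
  "nat \<Rightarrow> (quat \<Rightarrow> 'q \<Rightarrow> 'q) \<Rightarrow> (int \<Rightarrow> 'q \<Rightarrow> 'q) \<Rightarrow> 'q::ab_group_add set \<Rightarrow> bool" where
  "complete_universe n smul act Q \<longleftrightarrow>
     quat_rep (integer_mod_group n) smul act Q \<and>
     (\<exists>P. (\<forall>i. irreducible_rep (integer_mod_group n) smul act (P i)) \<and>
          direct_sum P Q \<and>
          (\<forall>r. infinite {i. iso_Psi n smul act r (P i)}))"

definition split_full_flag ::
  "'g monoid \<Rightarrow> (quat \<Rightarrow> 'q \<Rightarrow> 'q) \<Rightarrow> ('g \<Rightarrow> 'q \<Rightarrow> 'q) \<Rightarrow> 'q::ab_group_add set \<Rightarrow>
   (nat \<Rightarrow> 'q set) \<Rightarrow> bool" where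
  "split_full_flag G smul act W U \<longleftrightarrow>
     quat_rep G smul act W \<and>
     (\<forall>k. irreducible_rep G smul act (U k)) \<and> direct_sum U W"

definition flag_sum :: "(nat \<Rightarrow> 'q set) \<Rightarrow> nat \<Rightarrow> 'q::ab_group_add set" where
  "flag_sum U k = {\<Sum>i<k. f i | f. \<forall>i<k. f i \<in> U i}"


section \<open>Quaternionic projective space\<close>

definition quotient_topology :: "'a topology \<Rightarrow> ('a \<Rightarrow> 'b) \<Rightarrow> 'b topology" where
  "quotient_topology X q =
     topology (\<lambda>U. U \<subseteq> q ` topspace X \<and> openin X {x \<in> topspace X. q x \<in> U})"

definition module_basis ::
  "(quat \<Rightarrow> 'q \<Rightarrow> 'q) \<Rightarrow> 'q::ab_group_add set \<Rightarrow> nat \<Rightarrow> (nat \<Rightarrow> 'q) \<Rightarrow> bool" where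
  "module_basis smul V k b \<longleftrightarrow>
     (\<forall>i<k. b i \<in> V) \<and> (\<forall>v\<in>V. \<exists>!x. x \<in> {..<k} \<rightarrow>\<^sub>E UNIV \<and> v = (\<Sum>i<k. smul (x i) (b i)))"

definition finite_dim_module :: "(quat \<Rightarrow> 'q \<Rightarrow> 'q) \<Rightarrow> 'q::ab_group_add set \<Rightarrow> bool" where
  "finite_dim_module smul V \<longleftrightarrow> left_module smul V \<and> (\<exists>k b. module_basis smul V k b)"

text \<open>The Euclidean topology of a finite-dimensional module, transported along coordinates; all
  bases give the same open sets.\<close>

definition euclidean_module_topology ::
  "(quat \<Rightarrow> 'q \<Rightarrow> 'q) \<Rightarrow> 'q::ab_group_add set \<Rightarrow> 'q topology" where
  "euclidean_module_topology smul V =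
     topology (\<lambda>U. U \<subseteq> V \<and>
       (\<forall>k b. module_basis smul V k b \<longrightarrow>
          openin (product_topology (\<lambda>_. euclidean) {..<k})
            {x \<in> {..<k} \<rightarrow>\<^sub>E UNIV. (\<Sum>i<k. smul (x i) (b i)) \<in> U}))"

text \<open>The colimit of the Euclidean topologies of the finite-dimensional submodules; it is the
  Euclidean topology if \<open>W\<close> is itself finite-dimensional.\<close>

definition module_topology ::
  "(quat \<Rightarrow> 'q \<Rightarrow> 'q) \<Rightarrow> 'q::ab_group_add set \<Rightarrow> 'q topology" where
  "module_topology smul W =
     topology (\<lambda>U. U \<subseteq> W \<and>
       (\<forall>V. V \<subseteq> W \<and> finite_dim_module smul V \<longrightarrow>
          openin (euclidean_module_topology smul V) (U \<inter> V)))"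

definition quat_line :: "(quat \<Rightarrow> 'q \<Rightarrow> 'q) \<Rightarrow> 'q \<Rightarrow> 'q set" where
  "quat_line smul w = {smul l w | l. l \<noteq> 0}"

definition proj_space :: "(quat \<Rightarrow> 'q \<Rightarrow> 'q) \<Rightarrow> 'q::ab_group_add set \<Rightarrow> 'q set topology" where
  "proj_space smul W =
     quotient_topology (subtopology (module_topology smul W) (W - {0})) (quat_line smul)"


section \<open>Equivariant cell complexes\<close>

definition gspace :: "'g monoid \<Rightarrow> 'x topology \<Rightarrow> ('g \<Rightarrow> 'x \<Rightarrow> 'x) \<Rightarrow> bool" where
  "gspace G X \<alpha> \<longleftrightarrow>
     (\<forall>g\<in>carrier G. continuous_map X X (\<alpha> g)) \<and>
     (\<forall>x\<in>topspace X. \<alpha> \<one>\<^bsub>G\<^esub> x = x) \<and>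
     (\<forall>g\<in>carrier G. \<forall>h\<in>carrier G. \<forall>x\<in>topspace X. \<alpha> (g \<otimes>\<^bsub>G\<^esub> h) x = \<alpha> g (\<alpha> h x))"

text \<open>A real representation \<open>V\<close> of a subgroup \<open>K\<close> with an invariant inner product, carried by a
  subset of a normed space. Finite-dimensional subspaces have a unique vector space topology, so
  the ambient norm matters only through the topology it induces; disk and sphere are taken with
  respect to \<open>rinner\<close>.\<close>

record ('g, 'v) real_rep =
  rgroup :: "'g set"
  rspace :: "'v set"
  ract :: "'g \<Rightarrow> 'v \<Rightarrow> 'v"
  rinner :: "'v \<Rightarrow> 'v \<Rightarrow> real"

definition is_real_rep :: "'g monoid \<Rightarrow> ('g, 'v::real_normed_vector, 'z) real_rep_scheme \<Rightarrow> bool" where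
  "is_real_rep G R \<longleftrightarrow>
     (let K = rgroup R; V = rspace R; \<rho> = ract R; \<beta> = rinner R in
       subgroup K G \<and>
       (\<exists>B. finite B \<and> V = span B) \<and>
       (\<forall>k\<in>K. \<forall>v\<in>V. \<rho> k v \<in> V) \<and>
       (\<forall>k\<in>K. \<forall>v\<in>V. \<forall>w\<in>V. \<rho> k (v + w) = \<rho> k v + \<rho> k w) \<and>
       (\<forall>k\<in>K. \<forall>v\<in>V. \<forall>r. \<rho> k (r *\<^sub>R v) = r *\<^sub>R \<rho> k v) \<and>
       (\<forall>v\<in>V. \<rho> \<one>\<^bsub>G\<^esub> v = v) \<and>
       (\<forall>k\<in>K. \<forall>l\<in>K. \<forall>v\<in>V. \<rho> (k \<otimes>\<^bsub>G\<^esub> l) v = \<rho> k (\<rho> l v)) \<and>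
       (\<forall>u\<in>V. \<forall>v\<in>V. \<forall>w\<in>V. \<beta> (u + v) w = \<beta> u w + \<beta> v w) \<and>
       (\<forall>v\<in>V. \<forall>w\<in>V. \<forall>r. \<beta> (r *\<^sub>R v) w = r * \<beta> v w) \<and>
       (\<forall>v\<in>V. \<forall>w\<in>V. \<beta> v w = \<beta> w v) \<and>
       (\<forall>v\<in>V. v \<noteq> 0 \<longrightarrow> 0 < \<beta> v v) \<and>
       (\<forall>k\<in>K. \<forall>v\<in>V. \<forall>w\<in>V. \<beta> (\<rho> k v) (\<rho> k w) = \<beta> v w))"

definition unit_disk :: "('g, 'v::real_normed_vector, 'z) real_rep_scheme \<Rightarrow> 'v topology" where
  "unit_disk R = top_of_set {v \<in> rspace R. rinner R v v \<le> 1}"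

definition unit_sphere :: "('g, 'v::real_normed_vector, 'z) real_rep_scheme \<Rightarrow> 'v topology" where
  "unit_sphere R = top_of_set {v \<in> rspace R. rinner R v v = 1}"

definition fixed_dim :: "('g, 'v::real_normed_vector, 'z) real_rep_scheme \<Rightarrow> 'g set \<Rightarrow> nat" where
  "fixed_dim R S = dim {v \<in> rspace R. \<forall>k\<in>S. ract R k v = v}"

text \<open>The points of \<open>G \<times>\<^sub>K X\<close> are the classes of pairs under \<open>(g k, x) \<sim> (g, k x)\<close> for \<open>k\<close> in \<open>K\<close>.\<close>

definition induced_class ::
  "'g monoid \<Rightarrow> ('g, 'v, 'z) real_rep_scheme \<Rightarrow> 'g \<times> 'v \<Rightarrow> ('g \<times> 'v) set" where
  "induced_class G R = (\<lambda>(g, v). {(g \<otimes>\<^bsub>G\<^esub> k, ract R (inv\<^bsub>G\<^esub> k) v) | k. k \<in> rgroup R})"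

definition induced_space ::
  "'g monoid \<Rightarrow> ('g, 'v, 'z) real_rep_scheme \<Rightarrow> 'v topology \<Rightarrow> ('g \<times> 'v) set topology" where
  "induced_space G R X =
     quotient_topology (prod_topology (discrete_topology (carrier G)) X) (induced_class G R)"

definition induced_act :: "'g monoid \<Rightarrow> 'g \<Rightarrow> ('g \<times> 'v) set \<Rightarrow> ('g \<times> 'v) set" where
  "induced_act G h c = (\<lambda>(g, v). (h \<otimes>\<^bsub>G\<^esub> g, v)) ` c"

definition coprod_topology :: "'x topology \<Rightarrow> 'z topology \<Rightarrow> ('x + 'z) topology" where
  "coprod_topology X Z =
     topology (\<lambda>U. U \<subseteq> topspace X <+> topspace Z \<and> openin X (Inl -` U) \<and> openin Z (Inr -` U))"

text \<open>\<open>Y\<close> is the adjunction space of \<open>X\<close> and \<open>Z\<close> along \<open>\<phi>\<close>, defined on \<open>B \<subseteq> Z\<close>: the quotient of the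
  disjoint union by the equivalence relation generated by \<open>z \<sim> \<phi> z\<close>, where \<open>X\<close> is included in \<open>Y\<close>
  identically and \<open>Z\<close> maps to \<open>Y\<close> by \<open>\<Phi>\<close>.\<close>

definition adjunction_space ::
  "'x topology \<Rightarrow> 'z topology \<Rightarrow> 'z set \<Rightarrow> ('z \<Rightarrow> 'x) \<Rightarrow> 'x topology \<Rightarrow> ('z \<Rightarrow> 'x) \<Rightarrow> bool" where
  "adjunction_space X Z B \<phi> Y \<Phi> \<longleftrightarrow>
     quotient_map (coprod_topology X Z) Y (case_sum id \<Phi>) \<and>
     (\<forall>p\<in>topspace X <+> topspace Z. \<forall>q\<in>topspace X <+> topspace Z.
        case_sum id \<Phi> p = case_sum id \<Phi> q \<longleftrightarrow>
        equivclp (\<lambda>u v. \<exists>z\<in>B. u = Inr z \<and> v = Inl (\<phi> z)) p q)"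

record ('g, 'v, 'x) cell = "('g, 'v) real_rep" +
  cattach :: "('g \<times> 'v) set \<Rightarrow> 'x"

definition attach_cells ::
  "'g monoid \<Rightarrow> ('g \<Rightarrow> 'x \<Rightarrow> 'x) \<Rightarrow> 'x topology \<Rightarrow> 'x topology \<Rightarrow>
   'i set \<Rightarrow> ('i \<Rightarrow> ('g, 'v::real_normed_vector, 'x) cell) \<Rightarrow> bool" where
  "attach_cells G \<alpha> X Y I c \<longleftrightarrow>
     (\<forall>i\<in>I. is_real_rep G (c i) \<and>
        continuous_map (induced_space G (c i) (unit_sphere (c i))) X (cattach (c i)) \<and>
        (\<forall>g\<in>carrier G. \<forall>p\<in>topspace (induced_space G (c i) (unit_sphere (c i))).
           cattach (c i) (induced_act G g p) = \<alpha> g (cattach (c i) p))) \<and>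
     (\<exists>\<Phi>. adjunction_space X
             (sum_topology (\<lambda>i. induced_space G (c i) (unit_disk (c i))) I)
             (SIGMA i:I. topspace (induced_space G (c i) (unit_sphere (c i))))
             (\<lambda>(i, p). cattach (c i) p) Y \<Phi> \<and>
          (\<forall>i\<in>I. \<forall>g\<in>carrier G. \<forall>p\<in>topspace (induced_space G (c i) (unit_disk (c i))).
             \<Phi> (i, induced_act G g p) = \<alpha> g (\<Phi> (i, p))))"

text \<open>\<open>F m\<close> is the \<open>m\<close>-th filtration piece as a space in its own right; it has to be a subspace of
  \<open>X\<close>. The cells \<open>c m i\<close> with \<open>i \<in> I m\<close> are those attached to \<open>F m\<close> to form \<open>F (m + 1)\<close>.\<close>

definition cell_complex ::
  "'g monoid \<Rightarrow> 'x topology \<Rightarrow> ('g \<Rightarrow> 'x \<Rightarrow> 'x) \<Rightarrow> (nat \<Rightarrow> 'x topology) \<Rightarrow>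
   (nat \<Rightarrow> 'i set) \<Rightarrow> (nat \<Rightarrow> 'i \<Rightarrow> ('g, 'v::real_normed_vector, 'x) cell) \<Rightarrow> bool" where
  "cell_complex G X \<alpha> F I c \<longleftrightarrow>
     gspace G X \<alpha> \<and>
     (\<forall>m. topspace (F m) \<subseteq> topspace X \<and> F m = subtopology X (topspace (F m)) \<and>
          (\<forall>g\<in>carrier G. \<alpha> g ` topspace (F m) \<subseteq> topspace (F m)) \<and>
          topspace (F m) \<subseteq> topspace (F (Suc m))) \<and>
     F 0 = discrete_topology (topspace (F 0)) \<and>
     (\<forall>m. attach_cells G \<alpha> (F m) (F (Suc m)) (I m) (c m)) \<and>
     topspace X = (\<Union>m. topspace (F m)) \<and>
     (\<forall>U. U \<subseteq> topspace X \<longrightarrow>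
        (openin X U \<longleftrightarrow> (\<forall>m. openin (F m) (U \<inter> topspace (F m)))))"

text \<open>\<open>R1 \<lless> R2\<close> for two representations of the same subgroup of \<open>G\<close>.\<close>

definition rep_ll ::
  "'g monoid \<Rightarrow> ('g, 'v::real_normed_vector, 'z) real_rep_scheme \<Rightarrow>
   ('g, 'v, 'z) real_rep_scheme \<Rightarrow> bool" where
  "rep_ll G R1 R2 \<longleftrightarrow>
     (\<forall>S. subgroup S G \<and> S \<subseteq> rgroup R1 \<and> fixed_dim R1 S < fixed_dim R2 S \<longrightarrow>
        (\<forall>T. subgroup T G \<and> T \<subseteq> rgroup R1 \<and> S \<subseteq> T \<longrightarrow> fixed_dim R1 T \<le> fixed_dim R2 T))"

text \<open>The orbits of the discrete \<open>G\<close>-set \<open>F 0\<close> count as cells \<open>G \<times>\<^sub>H D(0)\<close> present from the start.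
  For them the parity condition and \<open>0 \<lless> V\<close> hold trivially, and there are finitely many of them
  by the finiteness of \<open>F 0\<close>, so the remaining conditions only mention the attached cells.\<close>

definition properly_even ::
  "'g monoid \<Rightarrow> (nat \<Rightarrow> 'x topology) \<Rightarrow>
   (nat \<Rightarrow> 'i set) \<Rightarrow> (nat \<Rightarrow> 'i \<Rightarrow> ('g, 'v::real_normed_vector, 'x) cell) \<Rightarrow> bool" where
  "properly_even G F I c \<longleftrightarrow>
     (\<forall>m. \<forall>i\<in>I m. \<forall>K. subgroup K G \<and> K \<subseteq> rgroup (c m i) \<longrightarrow> even (fixed_dim (c m i) K)) \<and>
     (\<forall>m l. m < l \<longrightarrow> (\<forall>i\<in>I m. \<forall>j\<in>I l. rgroup (c m i) = rgroup (c l j) \<longrightarrow>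
        rep_ll G (c m i) (c l j))) \<and>
     (\<forall>N>0. finite {(m, i). i \<in> I m \<and>
        (\<forall>K. subgroup K G \<and> K \<subseteq> rgroup (c m i) \<longrightarrow> fixed_dim (c m i) K \<le> N)}) \<and>
     finite (topspace (F 0)) \<and> (\<forall>m. finite (I m))"

text \<open>The cells are existentially quantified. Since each stage has finitely many of them, they can be
  indexed by natural numbers, and every finite-dimensional real representation can be carried by
  a subspace of the space of finitely supported real sequences.\<close>

definition properly_even_structure ::
  "'g monoid \<Rightarrow> 'x topology \<Rightarrow> ('g \<Rightarrow> 'x \<Rightarrow> 'x) \<Rightarrow> (nat \<Rightarrow> 'x topology) \<Rightarrow> bool" where
  "properly_even_structure G X \<alpha> F \<longleftrightarrow>
     (\<exists>(I :: nat \<Rightarrow> nat set) (c :: nat \<Rightarrow> nat \<Rightarrow> ('g, nat \<Rightarrow>\<^sub>0 real, 'x) cell).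
        cell_complex G X \<alpha> F I c \<and> properly_even G F I c)"

end

theory Submission
  imports Defs
begin

text \<open>
  Choosing in each \<open>W k\<close> the vector \<open>e k\<close> that corresponds to \<open>1 \<in> \<Psi>\<^sub>k\<close> identifies \<open>Q\<close> with the
  finitely supported sequences of quaternions, \<open>flag_sum W k\<close> with the sequences supported
  below \<open>k\<close>, and the action of \<open>g\<close> with the multiplication of the \<open>i\<close>-th entry by
  \<open>\<zeta>\<close> to the power \<open>i g\<close> from the right (\<open>flag_coordinates\<close>). All topologies in question can be read
  off in these coordinates (\<open>openin_proj_space_coords\<close>): a set of lines is open if and only if, for
  every \<open>k\<close>, the set of nonzero \<open>x\<close> supported below \<open>k\<close> that span such a line is open. Hence
  the filtration consists of subspaces and has \<open>P(Q)\<close> as its colimit.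

  A line supported on the entries \<open>0, \<dots>, k\<close> but not on \<open>0, \<dots>, k - 1\<close> has a unique spanning vector
  of norm \<open>1\<close> whose entry at \<open>k\<close> is real and positive, so it is determined by the remaining
  entries, a point of the open unit disk in quaternionic \<open>k\<close>-space. Letting that last entry be
  \<open>sqrt (1 - \<bar>v\<bar>\<^sup>2)\<close> defines the characteristic map on the closed disk; on the boundary sphere
  the last entry vanishes and the map lands in the previous stage. It
  exhibits the next stage as a quotient of the disk because the disk times the unit quaternions
  is compact and covers the unit sphere (\<open>openin_proj_flag_Suc\<close>). So each stage arises from
  its predecessor by attaching one cell, whose isotropy group is the whole group.

  Renormalising the last entry after an application of \<open>g\<close> multiplies everything by
  \<open>\<zeta>\<close> to the power \<open>- k g\<close> from the left. Writing an entry as \<open>a + b j\<close>, the linear action on the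
  disk therefore multiplies \<open>a\<close> and \<open>b\<close> of entry \<open>i\<close> by powers of \<open>\<zeta>\<close> with exponents \<open>(i - k) g\<close>
  and \<open>(- i - k) g\<close>. Up to sign the weights of the \<open>k\<close>-th cell are thus \<open>1, \<dots>, 2 k - 1\<close>, with \<open>k\<close>
  occurring twice. All fixed spaces are complex, which gives evenness. From \<open>k\<close> to \<open>k + 1\<close> one copy
  of the weight \<open>k\<close> gets lost, but whenever its character is trivial on a subgroup, so is that of
  the new weight \<open>2 k\<close>; hence the dimension of every fixed space is monotone in \<open>k\<close>
  (\<open>fixed_dim_projective_cell_mono\<close>), and the relation \<open>\<lless>\<close> between any two cells follows. The
  fixed space of the trivial subgroup has dimension \<open>4 k\<close>, so only finitely many cells stay below a
  given bound.
\<close>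

section \<open>The topologies given by their open sets\<close>

lemma openin_quotient_topology:
  "openin (quotient_topology X q) U \<longleftrightarrow>
     U \<subseteq> q ` topspace X \<and> openin X {x \<in> topspace X. q x \<in> U}"
proof -
  have "istopology (\<lambda>U. U \<subseteq> q ` topspace X \<and> openin X {x \<in> topspace X. q x \<in> U})"
    unfolding istopology_def
  proof (intro conjI allI impI)
    fix S T
    assume "S \<subseteq> q ` topspace X \<and> openin X {x \<in> topspace X. q x \<in> S}"
      "T \<subseteq> q ` topspace X \<and> openin X {x \<in> topspace X. q x \<in> T}"
    moreover have "{x \<in> topspace X. q x \<in> S \<inter> T}
        = {x \<in> topspace X. q x \<in> S} \<inter> {x \<in> topspace X. q x \<in> T}" by blast
    ultimately show "S \<inter> T \<subseteq> q ` topspace X" "openin X {x \<in> topspace X. q x \<in> S \<inter> T}"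
      by auto
  next
    fix \<K>
    assume K: "\<forall>U\<in>\<K>. U \<subseteq> q ` topspace X \<and> openin X {x \<in> topspace X. q x \<in> U}"
    then show "\<Union>\<K> \<subseteq> q ` topspace X" by blast
    have "{x \<in> topspace X. q x \<in> \<Union>\<K>} = (\<Union>U\<in>\<K>. {x \<in> topspace X. q x \<in> U})" by blast
    then show "openin X {x \<in> topspace X. q x \<in> \<Union>\<K>}"
      using K by auto
  qed
  then show ?thesis
    unfolding quotient_topology_def by simp
qed

lemma topspace_quotient_topology [simp]:
  "topspace (quotient_topology X q) = q ` topspace X"
proof -
  have "{x \<in> topspace X. q x \<in> q ` topspace X} = topspace X" by blast
  then have "openin (quotient_topology X q) (q ` topspace X)"
    by (simp add: openin_quotient_topology)
  moreover have "topspace (quotient_topology X q) \<subseteq> q ` topspace X"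
    using openin_quotient_topology[of X q] openin_topspace by blast
  ultimately show ?thesis
    using openin_subset by blast
qed

lemma quotient_map_quotient_topology: "quotient_map X (quotient_topology X q) q"
  by (auto simp: quotient_map_def openin_quotient_topology)

lemma openin_coprod_topology:
  "openin (coprod_topology X Z) U \<longleftrightarrow>
     U \<subseteq> topspace X <+> topspace Z \<and> openin X (Inl -` U) \<and> openin Z (Inr -` U)"
proof -
  have "istopology (\<lambda>U. U \<subseteq> topspace X <+> topspace Z \<and> openin X (Inl -` U) \<and> openin Z (Inr -` U))"
    unfolding istopology_def by (auto simp: vimage_Union)
  then show ?thesis
    unfolding coprod_topology_def by simp
qed

lemma topspace_coprod_topology [simp]:
  "topspace (coprod_topology X Z) = topspace X <+> topspace Z"
proof -
  have "Inl -` (topspace X <+> topspace Z) = topspace X" "Inr -` (topspace X <+> topspace Z) = topspace Z"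
    by auto
  then have "openin (coprod_topology X Z) (topspace X <+> topspace Z)"
    by (simp add: openin_coprod_topology)
  moreover have "topspace (coprod_topology X Z) \<subseteq> topspace X <+> topspace Z"
    using openin_coprod_topology[of X Z] openin_topspace by blast
  ultimately show ?thesis
    using openin_subset by blast
qed

lemma openin_euclidean_module_topology:
  "openin (euclidean_module_topology smul V) U \<longleftrightarrow> U \<subseteq> V \<and>
     (\<forall>k b. module_basis smul V k b \<longrightarrow>
        openin (product_topology (\<lambda>_. euclidean) {..<k})
          {x \<in> {..<k} \<rightarrow>\<^sub>E UNIV. (\<Sum>i<k. smul (x i) (b i)) \<in> U})"
proof -
  have "istopology (\<lambda>U. U \<subseteq> V \<and>
     (\<forall>k b. module_basis smul V k b \<longrightarrow>
        openin (product_topology (\<lambda>_. euclidean) {..<k})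
          {x \<in> {..<k} \<rightarrow>\<^sub>E UNIV. (\<Sum>i<k. smul (x i) (b i)) \<in> U}))"
    unfolding istopology_def
  proof (intro conjI allI impI; (elim conjE)?)
    fix S T and k :: nat and b
    let ?P = "\<lambda>U. {x \<in> {..<k} \<rightarrow>\<^sub>E UNIV. (\<Sum>i<k. smul (x i) (b i)) \<in> U}"
    assume S: "\<forall>k b. module_basis smul V k b \<longrightarrow>
        openin (product_topology (\<lambda>_. euclidean) {..<k})
          {x \<in> {..<k} \<rightarrow>\<^sub>E UNIV. (\<Sum>i<k. smul (x i) (b i)) \<in> S}"
      and T: "\<forall>k b. module_basis smul V k b \<longrightarrow>
        openin (product_topology (\<lambda>_. euclidean) {..<k})
          {x \<in> {..<k} \<rightarrow>\<^sub>E UNIV. (\<Sum>i<k. smul (x i) (b i)) \<in> T}"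
      and b: "module_basis smul V k b"
    have "?P (S \<inter> T) = ?P S \<inter> ?P T" by blast
    then show "openin (product_topology (\<lambda>_. euclidean) {..<k}) (?P (S \<inter> T))"
      using S T b by auto
  next
    fix \<K> and k :: nat and b
    let ?P = "\<lambda>U. {x \<in> {..<k} \<rightarrow>\<^sub>E UNIV. (\<Sum>i<k. smul (x i) (b i)) \<in> U}"
    assume "\<forall>U\<in>\<K>. U \<subseteq> V \<and> (\<forall>k b. module_basis smul V k b \<longrightarrow>
        openin (product_topology (\<lambda>_. euclidean) {..<k})
          {x \<in> {..<k} \<rightarrow>\<^sub>E UNIV. (\<Sum>i<k. smul (x i) (b i)) \<in> U})"
      and b: "module_basis smul V k b"
    moreover have "?P (\<Union>\<K>) = (\<Union>U\<in>\<K>. ?P U)" by blast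
    ultimately show "openin (product_topology (\<lambda>_. euclidean) {..<k}) (?P (\<Union>\<K>))"
      by auto
  qed blast+
  then show ?thesis
    unfolding euclidean_module_topology_def by simp
qed

lemma openin_module_topology:
  "openin (module_topology smul W) U \<longleftrightarrow> U \<subseteq> W \<and>
     (\<forall>V. V \<subseteq> W \<and> finite_dim_module smul V \<longrightarrow>
        openin (euclidean_module_topology smul V) (U \<inter> V))"
proof -
  have "istopology (\<lambda>U. U \<subseteq> W \<and> (\<forall>V. V \<subseteq> W \<and> finite_dim_module smul V \<longrightarrow>
        openin (euclidean_module_topology smul V) (U \<inter> V)))"
    unfolding istopology_def
  proof (intro conjI allI impI; (elim conjE)?)
    fix S T V
    assume "\<forall>V. V \<subseteq> W \<and> finite_dim_module smul V \<longrightarrow>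
          openin (euclidean_module_topology smul V) (S \<inter> V)"
      "\<forall>V. V \<subseteq> W \<and> finite_dim_module smul V \<longrightarrow>
          openin (euclidean_module_topology smul V) (T \<inter> V)"
      "V \<subseteq> W" "finite_dim_module smul V"
    moreover have "S \<inter> T \<inter> V = (S \<inter> V) \<inter> (T \<inter> V)" by blast
    ultimately show "openin (euclidean_module_topology smul V) (S \<inter> T \<inter> V)" by auto
  next
    fix \<K> V
    assume "\<forall>U\<in>\<K>. U \<subseteq> W \<and> (\<forall>V. V \<subseteq> W \<and> finite_dim_module smul V \<longrightarrow>
          openin (euclidean_module_topology smul V) (U \<inter> V))"
      "V \<subseteq> W" "finite_dim_module smul V"
    then have "\<forall>U\<in>\<K>. openin (euclidean_module_topology smul V) (U \<inter> V)" by blast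
    then have "openin (euclidean_module_topology smul V) (\<Union>U\<in>\<K>. U \<inter> V)" by blast
    then show "openin (euclidean_module_topology smul V) (\<Union>\<K> \<inter> V)"
      by (simp only: Int_Union2)
  qed blast+
  then show ?thesis
    unfolding module_topology_def by simp
qed


section \<open>Coordinates\<close>

definition coord_space :: "nat \<Rightarrow> (nat \<Rightarrow> quat) set" where
  "coord_space k = {x. \<forall>i\<ge>k. x i = 0}"

definition nonzero_coords :: "nat \<Rightarrow> (nat \<Rightarrow> quat) set" where
  "nonzero_coords k = coord_space k - {\<lambda>_. 0}"

definition fin_coords :: "(nat \<Rightarrow> quat) set" where
  "fin_coords = (\<Union>k. coord_space k)"

lemma coord_space_mono: "k \<le> l \<Longrightarrow> coord_space k \<subseteq> coord_space l"
  by (auto simp: coord_space_def)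

lemma nonzero_coords_mono: "k \<le> l \<Longrightarrow> nonzero_coords k \<subseteq> nonzero_coords l"
  using coord_space_mono by (auto simp: nonzero_coords_def)

lemma coord_space_subset_fin: "coord_space k \<subseteq> fin_coords"
  by (auto simp: fin_coords_def)

lemma fin_coords_iff: "x \<in> fin_coords \<longleftrightarrow> finite {i. x i \<noteq> 0}"
proof
  assume "x \<in> fin_coords"
  then obtain k where "x \<in> coord_space k" by (auto simp: fin_coords_def)
  then have "{i. x i \<noteq> 0} \<subseteq> {..<k}"
    by (auto simp: coord_space_def intro: leI not_less)
  then show "finite {i. x i \<noteq> 0}" by (rule finite_subset) simp
next
  assume "finite {i. x i \<noteq> 0}"
  then obtain k where "\<forall>i\<in>{i. x i \<noteq> 0}. i < k"
    using finite_nat_set_iff_bounded by blast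
  then have "x \<in> coord_space k" by (force simp: coord_space_def)
  then show "x \<in> fin_coords" by (auto simp: fin_coords_def)
qed

lemma closed_coord_space: "closed (coord_space k)"
proof -
  have "coord_space k = (\<Inter>i\<in>{k..}. {x. x i = 0})"
    by (auto simp: coord_space_def)
  moreover have "closed {x::nat \<Rightarrow> quat. x i = 0}" for i
    by (intro closed_Collect_eq) simp_all
  ultimately show ?thesis by auto
qed

lemma open_nonzero_fun: "open {x::nat \<Rightarrow> quat. x \<noteq> (\<lambda>_. 0)}"
proof -
  have "{x::nat \<Rightarrow> quat. x \<noteq> (\<lambda>_. 0)} = (\<Union>i. {x. x i \<noteq> 0})" by auto
  moreover have "open {x::nat \<Rightarrow> quat. x i \<noteq> 0}" for i
    by (intro open_Collect_neq) simp_all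
  ultimately show ?thesis by auto
qed

lemma openin_nonzero_coords: "openin (top_of_set (coord_space k)) (nonzero_coords k)"
proof -
  have "nonzero_coords k = coord_space k \<inter> {x. x \<noteq> (\<lambda>_. 0)}" by (auto simp: nonzero_coords_def)
  then show ?thesis using open_nonzero_fun by (auto simp: openin_open)
qed

lemma left_module_sum:
  fixes k :: nat
  assumes "left_module smul V" "\<And>i. i < k \<Longrightarrow> b i \<in> V"
  shows "(\<Sum>i<k. smul (x i) (b i)) \<in> V"
  using assms(2)
proof (induction k)
  case 0
  then show ?case using assms(1) by (simp add: left_module_def)
next
  case (Suc k)
  then show ?case using assms(1) by (auto simp: left_module_def)
qed

text \<open>A basis of \<open>Q\<close> indexed by the natural numbers, given by the linear bijection \<open>vec\<close> from
  coordinate sequences to vectors. Coordinates are sequences of type \<^typ>\<open>nat \<Rightarrow> quat\<close>, so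
  the ordinary product topology and continuity on subsets apply to them.\<close>

locale coordinates =
  fixes smul :: "quat \<Rightarrow> 'q::ab_group_add \<Rightarrow> 'q" and Q :: "'q set" and vec :: "(nat \<Rightarrow> quat) \<Rightarrow> 'q"
  assumes bij_vec: "bij_betw vec fin_coords Q"
    and vec_add: "x \<in> fin_coords \<Longrightarrow> y \<in> fin_coords \<Longrightarrow> vec (\<lambda>i. x i + y i) = vec x + vec y"
    and vec_smul: "x \<in> fin_coords \<Longrightarrow> vec (\<lambda>i. l * x i) = smul l (vec x)"
begin

definition flag :: "nat \<Rightarrow> 'q set" where
  "flag k = vec ` coord_space k"

definition line :: "(nat \<Rightarrow> quat) \<Rightarrow> 'q set" where
  "line x = quat_line smul (vec x)"

lemma fin_add: "x \<in> fin_coords \<Longrightarrow> y \<in> fin_coords \<Longrightarrow> (\<lambda>i. x i + y i) \<in> fin_coords"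
  unfolding fin_coords_iff
  by (rule finite_subset[of _ "{i. x i \<noteq> 0} \<union> {i. y i \<noteq> 0}"]) auto

lemma fin_mult: "x \<in> fin_coords \<Longrightarrow> (\<lambda>i. l * x i * m i) \<in> fin_coords"
  unfolding fin_coords_iff
  by (rule finite_subset[of _ "{i. x i \<noteq> 0}"]) auto

lemma fin_smul: "x \<in> fin_coords \<Longrightarrow> (\<lambda>i. l * x i) \<in> fin_coords"
  using fin_mult[of x l "\<lambda>_. 1"] by simp

lemma zero_fin: "(\<lambda>_. 0) \<in> fin_coords"
  by (simp add: fin_coords_iff)

lemma vec_zero [simp]: "vec (\<lambda>_. 0) = 0"
  using vec_add[OF zero_fin zero_fin] by simp

lemma vec_eq_iff: "x \<in> fin_coords \<Longrightarrow> y \<in> fin_coords \<Longrightarrow> vec x = vec y \<longleftrightarrow> x = y"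
  using bij_vec by (auto simp: bij_betw_def inj_on_def)

lemma vec_eq_0_iff: "x \<in> fin_coords \<Longrightarrow> vec x = 0 \<longleftrightarrow> x = (\<lambda>_. 0)"
  using vec_eq_iff[OF _ zero_fin] by simp

lemma Q_eq_Union_flag: "Q = (\<Union>k. flag k)"
  using bij_vec by (auto simp: bij_betw_def flag_def fin_coords_def)

lemma flag_mono: "k \<le> l \<Longrightarrow> flag k \<subseteq> flag l"
  using coord_space_mono by (auto simp: flag_def)

lemma vec_linear_combination:
  fixes k :: nat
  assumes "\<And>i. i < k \<Longrightarrow> c i \<in> fin_coords"
  shows "(\<lambda>j. \<Sum>i<k. x i * c i j) \<in> fin_coords"
    and "vec (\<lambda>j. \<Sum>i<k. x i * c i j) = (\<Sum>i<k. smul (x i) (vec (c i)))"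
proof -
  have "(\<lambda>j. \<Sum>i<k. x i * c i j) \<in> fin_coords \<and>
        vec (\<lambda>j. \<Sum>i<k. x i * c i j) = (\<Sum>i<k. smul (x i) (vec (c i)))"
    using assms
  proof (induction k)
    case 0
    then show ?case by (simp add: zero_fin)
  next
    case (Suc k)
    have c: "c k \<in> fin_coords" and IH: "(\<lambda>j. \<Sum>i<k. x i * c i j) \<in> fin_coords"
      "vec (\<lambda>j. \<Sum>i<k. x i * c i j) = (\<Sum>i<k. smul (x i) (vec (c i)))"
      using Suc by auto
    show ?case
      using fin_add[OF IH(1) fin_smul[OF c]] vec_add[OF IH(1) fin_smul[OF c], of "x k"] IH(2)
        vec_smul[OF c, of "x k"] by simp
  qed
  then show "(\<lambda>j. \<Sum>i<k. x i * c i j) \<in> fin_coords"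
    and "vec (\<lambda>j. \<Sum>i<k. x i * c i j) = (\<Sum>i<k. smul (x i) (vec (c i)))" by auto
qed

lemma left_module_vec_image:
  assumes "S \<subseteq> fin_coords" "(\<lambda>_. 0) \<in> S" "\<And>x y. x \<in> S \<Longrightarrow> y \<in> S \<Longrightarrow> (\<lambda>i. x i + y i) \<in> S"
    "\<And>l x. x \<in> S \<Longrightarrow> (\<lambda>i. l * x i) \<in> S"
  shows "left_module smul (vec ` S)"
proof -
  have add: "vec x + vec y = vec (\<lambda>i. x i + y i)" if "x \<in> S" "y \<in> S" for x y
    using vec_add[of x y] that subsetD[OF assms(1)] by simp
  have mul: "smul l (vec x) = vec (\<lambda>i. l * x i)" if "x \<in> S" for l x
    using vec_smul[of x l] that subsetD[OF assms(1)] by simp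
  have "0 \<in> vec ` S" using assms(2) vec_zero by (metis imageI)
  then show ?thesis
    unfolding left_module_def
    by (auto simp: add mul assms distrib_left distrib_right mult.assoc)
qed

lemma left_module_flag: "left_module smul (flag k)"
  unfolding flag_def
  by (rule left_module_vec_image) (auto simp: coord_space_def fin_coords_def)

text \<open>The standard basis makes \<open>flag k\<close> finite-dimensional, so it is one of the submodules whose
  Euclidean topologies define the colimit.\<close>

lemma module_basis_flag: "module_basis smul (flag k) k (\<lambda>i. vec (\<lambda>j. if j = i then 1 else 0))"
  unfolding module_basis_def
proof (intro conjI allI impI ballI)
  let ?u = "\<lambda>i j. if j = i then 1 else (0::quat)"
  show "vec (?u i) \<in> flag k" if "i < k" for i
    using that by (auto simp: flag_def coord_space_def)
  have u: "?u i \<in> fin_coords" for i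
    by (simp add: fin_coords_iff)
  have sum: "(\<Sum>i<k. smul (x i) (vec (?u i))) = vec (\<lambda>j. if j < k then x j else 0)" for x
  proof -
    have "(\<lambda>j. \<Sum>i<k. x i * ?u i j) = (\<lambda>j. if j < k then x j else 0)"
      by (auto simp: if_distrib[of "(*) _"] cong: if_cong)
    then show ?thesis using vec_linear_combination(2)[of k ?u x] u by simp
  qed
  fix v assume "v \<in> flag k"
  then obtain y where y: "y \<in> coord_space k" "v = vec y" by (auto simp: flag_def)
  have trunc: "(\<lambda>j. if j < k then x j else 0) \<in> coord_space k" for x :: "nat \<Rightarrow> quat"
    by (auto simp: coord_space_def)
  have coeffs: "v = (\<Sum>i<k. smul (x i) (vec (?u i))) \<longleftrightarrow> y = (\<lambda>j. if j < k then x j else 0)" for x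
    unfolding sum y(2) using vec_eq_iff trunc y(1) coord_space_subset_fin by blast
  then show "\<exists>!x. x \<in> {..<k} \<rightarrow>\<^sub>E UNIV \<and> v = (\<Sum>i<k. smul (x i) (vec (?u i)))"
  proof (intro ex1I[of _ "restrict y {..<k}"])
    fix x assume "x \<in> {..<k} \<rightarrow>\<^sub>E UNIV \<and> v = (\<Sum>i<k. smul (x i) (vec (?u i)))"
    then have "x \<in> extensional {..<k}" "y = (\<lambda>j. if j < k then x j else 0)"
      using coeffs by (auto simp: PiE_def)
    then show "x = restrict y {..<k}" by (auto simp: restrict_def extensional_def)
  qed (use y(1) coeffs in \<open>auto simp: coord_space_def\<close>)
qed

lemma finite_dim_flag: "finite_dim_module smul (flag k)"
  using left_module_flag module_basis_flag by (auto simp: finite_dim_module_def)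

text \<open>Each of the finitely many basis vectors has finite support.\<close>

lemma finite_dim_in_flag:
  assumes "finite_dim_module smul V" "V \<subseteq> Q"
  shows "\<exists>k. V \<subseteq> flag k"
proof -
  obtain k b where b: "module_basis smul V k b"
    using assms(1) by (auto simp: finite_dim_module_def)
  then have "\<forall>i<k. b i \<in> Q"
    using assms(2) unfolding module_basis_def by blast
  then have "\<forall>i<k. \<exists>m. b i \<in> flag m"
    unfolding Q_eq_Union_flag by blast
  then obtain m where m: "\<And>i. i < k \<Longrightarrow> b i \<in> flag (m i)" by metis
  \<comment> \<open>any common upper bound of the \<open>m i\<close>\<close>
  define M where "M = (\<Sum>i<k. m i)"
  have bM: "b i \<in> flag M" if "i < k" for i
    using m[OF that] flag_mono[of "m i" M] member_le_sum[of i "{..<k}" m] that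
    by (auto simp: M_def)
  have "V \<subseteq> flag M"
  proof
    fix v assume "v \<in> V"
    then obtain x where "v = (\<Sum>i<k. smul (x i) (b i))"
      using b by (auto simp: module_basis_def)
    moreover have "(\<Sum>i<k. smul (x i) (b i)) \<in> flag M"
      by (rule left_module_sum[OF left_module_flag]) (use bM in auto)
    ultimately show "v \<in> flag M" by simp
  qed
  then show ?thesis by blast
qed

text \<open>A submodule with a finite basis lies in some \<open>flag k\<close> with \<open>k \<in> D\<close>, and the inclusion is
  continuous because linear maps are continuous in coordinates. So the colimit over all
  finite-dimensional submodules can be computed from the flag alone, and for each stage from its
  standard basis alone. The set \<open>D\<close> allows for a single stage as well as for the whole module.\<close>

lemma openin_module_topology_coords:
  assumes D: "\<And>k. k \<in> D \<Longrightarrow> flag k \<subseteq> W"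
    and cofinal: "\<And>V. V \<subseteq> W \<Longrightarrow> finite_dim_module smul V \<Longrightarrow> \<exists>k\<in>D. V \<subseteq> flag k"
  shows "openin (module_topology smul W) U \<longleftrightarrow>
    U \<subseteq> W \<and> (\<forall>k\<in>D. openin (top_of_set (coord_space k)) {x \<in> coord_space k. vec x \<in> U})"
proof (intro iffI conjI ballI)
  assume "openin (module_topology smul W) U"
  then have U: "U \<subseteq> W" "\<And>V. V \<subseteq> W \<Longrightarrow> finite_dim_module smul V \<Longrightarrow>
      openin (euclidean_module_topology smul V) (U \<inter> V)"
    by (auto simp: openin_module_topology)
  then show "U \<subseteq> W" by simp
  fix k assume "k \<in> D"
  let ?u = "\<lambda>i j. if j = i then 1 else (0::quat)"
  let ?S = "{x \<in> {..<k} \<rightarrow>\<^sub>E UNIV. (\<Sum>i<k. smul (x i) (vec (?u i))) \<in> U \<inter> flag k}"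
  have "openin (product_topology (\<lambda>_. euclidean) {..<k}) ?S"
    using U(2)[OF D[OF \<open>k \<in> D\<close>] finite_dim_flag] module_basis_flag
    by (auto simp: openin_euclidean_module_topology)
  moreover have "continuous_map (top_of_set (coord_space k)) (product_topology (\<lambda>_. euclidean) {..<k})
      (\<lambda>x. restrict x {..<k})"
    by (auto simp: continuous_map_componentwise intro: continuous_on_subset[OF continuous_on_product_coordinates])
  ultimately have "openin (top_of_set (coord_space k)) {x \<in> coord_space k. restrict x {..<k} \<in> ?S}"
    using openin_continuous_map_preimage by fastforce
  moreover have "restrict x {..<k} \<in> ?S \<longleftrightarrow> vec x \<in> U" if x: "x \<in> coord_space k" for x
  proof -
    have "(\<lambda>j. \<Sum>i<k. restrict x {..<k} i * ?u i j) = x"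
      using x by (auto simp: if_distrib[of "(*) _"] coord_space_def cong: if_cong)
    then have "(\<Sum>i<k. smul (restrict x {..<k} i) (vec (?u i))) = vec x"
      using vec_linear_combination(2)[of k ?u "restrict x {..<k}"] by (simp add: fin_coords_iff)
    then show ?thesis using x by (auto simp: flag_def)
  qed
  then have "{x \<in> coord_space k. restrict x {..<k} \<in> ?S} = {x \<in> coord_space k. vec x \<in> U}"
    by blast
  ultimately show "openin (top_of_set (coord_space k)) {x \<in> coord_space k. vec x \<in> U}"
    by (simp only:)
next
  assume U: "U \<subseteq> W \<and> (\<forall>k\<in>D. openin (top_of_set (coord_space k)) {x \<in> coord_space k. vec x \<in> U})"
  show "openin (module_topology smul W) U"
    unfolding openin_module_topology openin_euclidean_module_topology
  proof (intro conjI allI impI; (elim conjE)?)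
    fix V k b
    assume V: "V \<subseteq> W" "finite_dim_module smul V" and b: "module_basis smul V k b"
    obtain m where m: "m \<in> D" "V \<subseteq> flag m" using cofinal[OF V] by blast
    have "\<forall>i<k. \<exists>c. c \<in> coord_space m \<and> vec c = b i"
      using b m(2) by (fastforce simp: module_basis_def flag_def)
    then obtain c where c: "\<And>i. i < k \<Longrightarrow> c i \<in> coord_space m" "\<And>i. i < k \<Longrightarrow> vec (c i) = b i"
      by metis
    let ?T = "\<lambda>x j. \<Sum>i<k. x i * c i j"
    let ?P = "product_topology (\<lambda>_. euclidean :: quat topology) {..<k}"
    have comb: "vec (?T x) = (\<Sum>i<k. smul (x i) (b i))" for x
      using vec_linear_combination(2)[of k c x] c coord_space_subset_fin by auto
    have T: "?T x \<in> coord_space m" for x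
      using c(1) by (auto simp: coord_space_def)
    have "continuous_map ?P euclidean (\<lambda>x. x i * c i j)" if "i < k" for i j
    proof -
      have "continuous_map ?P euclidean (\<lambda>x. x i)"
        using that continuous_map_product_projection[of i "{..<k}" "\<lambda>_. euclidean"] by simp
      moreover have "continuous_map euclidean euclidean (\<lambda>q. q * c i j)"
        by (auto intro: continuous_intros)
      ultimately show ?thesis
        using continuous_map_compose[of ?P euclidean "\<lambda>x. x i" euclidean "\<lambda>q. q * c i j"] by (simp add: o_def)
    qed
    then have "continuous_map ?P euclidean (\<lambda>x. ?T x j)" for j
      by (intro continuous_map_sum) auto
    then have "continuous_map ?P (product_topology (\<lambda>_. euclidean) UNIV) ?T"
      by (simp add: continuous_map_componentwise_UNIV)
    then have "continuous_map ?P (top_of_set (coord_space m)) ?T"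
      using T by (simp add: euclidean_product_topology continuous_map_in_subtopology image_subset_iff)
    then have "openin ?P {x \<in> topspace ?P. ?T x \<in> {x \<in> coord_space m. vec x \<in> U}}"
      using U m(1) by (intro openin_continuous_map_preimage) auto
    moreover have "(\<Sum>i<k. smul (x i) (b i)) \<in> V" for x
      using V(2) b by (intro left_module_sum) (auto simp: finite_dim_module_def module_basis_def)
    ultimately show "openin ?P {x \<in> {..<k} \<rightarrow>\<^sub>E UNIV. (\<Sum>i<k. smul (x i) (b i)) \<in> U \<inter> V}"
      using T comb by simp
  qed (use U in auto)
qed

text \<open>The nonzero vectors form an open set, so removing the origin and passing to the quotient
  preserves the description by coordinates.\<close>

lemma openin_proj_space_coords:
  assumes D: "\<And>k. k \<in> D \<Longrightarrow> flag k \<subseteq> W"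
    and cofinal: "\<And>V. V \<subseteq> W \<Longrightarrow> finite_dim_module smul V \<Longrightarrow> \<exists>k\<in>D. V \<subseteq> flag k"
  shows "openin (proj_space smul W) U \<longleftrightarrow> U \<subseteq> quat_line smul ` (W - {0}) \<and>
    (\<forall>k\<in>D. openin (top_of_set (nonzero_coords k)) {x \<in> nonzero_coords k. line x \<in> U})"
proof -
  note mod = openin_module_topology_coords[OF assms]
  have nz: "{x \<in> coord_space k. vec x \<in> {w \<in> W - {0}. P w}} = {x \<in> nonzero_coords k. P (vec x)}"
    if "k \<in> D" for P k
    using D[OF that] vec_eq_0_iff coord_space_subset_fin by (fastforce simp: nonzero_coords_def flag_def)
  have "{x \<in> coord_space k. vec x \<in> W} = coord_space k" if "k \<in> D" for k
    using D[OF that] by (auto simp: flag_def)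
  then have "openin (module_topology smul W) W"
    using mod[of W] by simp
  moreover have "topspace (module_topology smul W) \<subseteq> W"
    using openin_module_topology[of smul W] openin_topspace by blast
  ultimately have top: "topspace (module_topology smul W) = W"
    using openin_subset by blast
  have "openin (module_topology smul W) (W - {0})"
    using mod[of "W - {0}"] nz[of _ "\<lambda>_. True"] openin_nonzero_coords by auto
  then have *: "openin (subtopology (module_topology smul W) (W - {0})) {w \<in> W - {0}. quat_line smul w \<in> U} \<longleftrightarrow>
      openin (module_topology smul W) {w \<in> W - {0}. quat_line smul w \<in> U}"
    by (auto simp: openin_open_subtopology)
  have "openin (top_of_set (coord_space k)) {x \<in> nonzero_coords k. line x \<in> U} \<longleftrightarrow>
      openin (top_of_set (nonzero_coords k)) {x \<in> nonzero_coords k. line x \<in> U}" for k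
  proof -
    have "nonzero_coords k = coord_space k \<inter> nonzero_coords k" by (auto simp: nonzero_coords_def)
    then show ?thesis
      using openin_open_subtopology[OF openin_nonzero_coords[of k]] by (auto simp: subtopology_subtopology)
  qed
  then have "openin (module_topology smul W) {w \<in> W - {0}. quat_line smul w \<in> U} \<longleftrightarrow>
      (\<forall>k\<in>D. openin (top_of_set (nonzero_coords k)) {x \<in> nonzero_coords k. line x \<in> U})"
    using nz[of _ "\<lambda>w. quat_line smul w \<in> U"]
    by (simp only: mod line_def) (simp cong: ball_cong add: subset_iff)
  moreover have "topspace (subtopology (module_topology smul W) (W - {0})) = W - {0}"
    using top by auto
  ultimately show ?thesis
    unfolding proj_space_def openin_quotient_topology by (simp only: *)
qed

end


section \<open>Roots of unity\<close>

definition root_power :: "nat \<Rightarrow> int \<Rightarrow> quat" where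
  "root_power n m = quat_of_complex (cis (2 * pi / real n) powi m)"

lemma Psi_act_eq: "Psi_act n r a q = q * root_power n (r * a)"
  by (simp add: Psi_act_def root_power_def)

lemma root_power_0 [simp]: "root_power n 0 = 1"
  by (simp add: root_power_def quat_of_complex_def one_quat_def)

lemma root_power_add: "root_power n (a + b) = root_power n a * root_power n b"
  by (simp add: root_power_def quat_of_complex_def times_quat_def power_int_add)

lemma cis_power_int: "cis t powi m = cis (of_int m * t)"
  by (cases m rule: int_cases2)
    (auto simp: power_int_minus Complex.DeMoivre)

lemma norm_root_power [simp]: "norm (root_power n a) = 1"
  by (simp add: root_power_def norm_quat_def quat_of_complex_def cis_power_int)

lemma root_power_nonzero [simp]: "root_power n a \<noteq> 0"
  using norm_root_power[of n a] by (metis norm_zero zero_neq_one)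

text \<open>Only this equivalence enters the computation of fixed spaces: it turns a condition on complex
  numbers into divisibility.\<close>

lemma qfst_root_power_eq_1_iff:
  assumes "n \<ge> 1"
  shows "qfst (root_power n a) = 1 \<longleftrightarrow> int n dvd a"
proof -
  have "qfst (root_power n a) = cis (2 * pi * (of_int a / real n))"
    by (simp add: root_power_def quat_of_complex_def cis_power_int mult_ac)
  moreover have "cis (2 * pi * x) = 1 \<longleftrightarrow> x \<in> \<int>" for x
  proof -
    have "cis (2 * pi * x) = 1 \<longleftrightarrow> cos (2 * pi * x) = 1"
      by (auto simp: complex_eq_iff cos_one_sin_zero)
    also have "\<dots> \<longleftrightarrow> x \<in> \<int>"
      by (auto simp: cos_one_2pi_int elim!: Ints_cases)
    finally show ?thesis .
  qed
  moreover have "of_int a / real n \<in> \<int> \<longleftrightarrow> int n dvd a"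
  proof
    assume "of_int a / real n \<in> \<int>"
    then obtain b where "of_int a / real n = of_int b" by (auto elim: Ints_cases)
    then have "real_of_int a = of_int (b * int n)" using assms by (simp add: field_simps)
    then show "int n dvd a" by (simp only: of_int_eq_iff dvd_triv_right)
  qed (use assms in \<open>auto elim!: dvdE\<close>)
  ultimately show ?thesis by (simp only:)
qed

lemma root_power_eq_1: "n \<ge> 1 \<Longrightarrow> int n dvd a \<Longrightarrow> root_power n a = 1"
  using qfst_root_power_eq_1_iff[of n a] by (simp add: quat_eq_iff root_power_def quat_of_complex_def one_quat_def)

lemma root_power_cong:
  assumes "n \<ge> 1" "int n dvd a - b"
  shows "root_power n a = root_power n b"
  using root_power_add[of n "a - b" b] root_power_eq_1[OF assms] by simp

lemma root_power_commute: "root_power n a * root_power n b = root_power n b * root_power n a"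
  by (metis root_power_add add.commute)


section \<open>Projective spaces in homogeneous coordinates\<close>

context coordinates
begin

lemma nonzero_subset_fin: "nonzero_coords k \<subseteq> fin_coords"
  using coord_space_subset_fin by (auto simp: nonzero_coords_def)

lemma line_eq_image: "x \<in> fin_coords \<Longrightarrow> line x = {vec (\<lambda>i. l * x i) | l. l \<noteq> 0}"
  by (simp add: line_def quat_line_def vec_smul)

lemma line_eq_iff:
  assumes "x \<in> fin_coords" "y \<in> fin_coords"
  shows "line x = line y \<longleftrightarrow> (\<exists>l. l \<noteq> 0 \<and> y = (\<lambda>i. l * x i))"
proof
  assume eq: "line x = line y"
  have "vec (\<lambda>i. 1 * y i) \<in> line y"
    unfolding line_eq_image[OF assms(2)] by (rule CollectI) (intro exI[of _ 1]; simp)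
  then obtain l where l: "l \<noteq> 0" "vec y = vec (\<lambda>i. l * x i)"
    using eq line_eq_image[OF assms(1)] by auto
  then show "\<exists>l. l \<noteq> 0 \<and> y = (\<lambda>i. l * x i)"
    using vec_eq_iff[OF assms(2) fin_smul[OF assms(1)]] by blast
next
  assume "\<exists>l. l \<noteq> 0 \<and> y = (\<lambda>i. l * x i)"
  then obtain l where l: "l \<noteq> 0" and y: "y = (\<lambda>i. l * x i)" by blast
  have cancel: "inverse l * (l * q) = q" for q
    using l by (simp flip: mult.assoc)
  have "\<exists>m'. vec (\<lambda>i. m * x i) = vec (\<lambda>i. m' * y i) \<and> m' \<noteq> 0" if "m \<noteq> 0" for m
    using that l by (intro exI[of _ "m * inverse l"]) (simp add: y mult.assoc cancel)
  moreover have "\<exists>m'. vec (\<lambda>i. m * y i) = vec (\<lambda>i. m' * x i) \<and> m' \<noteq> 0" if "m \<noteq> 0" for m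
    using that l by (intro exI[of _ "m * l"]) (simp add: y mult.assoc)
  ultimately show "line x = line y"
    unfolding line_eq_image[OF assms(1)] line_eq_image[OF assms(2)] by blast
qed

text \<open>The support of a spanning vector depends only on the line.\<close>

lemma line_in_image_iff:
  assumes "x \<in> nonzero_coords l"
  shows "line x \<in> line ` nonzero_coords k \<longleftrightarrow> x \<in> nonzero_coords k"
proof
  assume "line x \<in> line ` nonzero_coords k"
  then obtain y where y: "y \<in> nonzero_coords k" "line y = line x" by auto
  then obtain m where "x = (\<lambda>i. m * y i)"
    using line_eq_iff assms nonzero_subset_fin by blast
  then show "x \<in> nonzero_coords k"
    using y(1) assms by (auto simp: nonzero_coords_def coord_space_def)
qed auto

lemma lines_flag: "quat_line smul ` (flag k - {0}) = line ` nonzero_coords k"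
proof -
  have "flag k - {0} = vec ` nonzero_coords k"
    using vec_eq_0_iff coord_space_subset_fin by (fastforce simp: flag_def nonzero_coords_def)
  then show ?thesis by (simp add: image_image line_def)
qed

lemma lines_Q: "quat_line smul ` (Q - {0}) = (\<Union>k. line ` nonzero_coords k)"
  unfolding Q_eq_Union_flag lines_flag[symmetric] by blast

lemma openin_proj_flag:
  "openin (proj_space smul (flag k)) U \<longleftrightarrow> U \<subseteq> line ` nonzero_coords k \<and>
     openin (top_of_set (nonzero_coords k)) {x \<in> nonzero_coords k. line x \<in> U}"
  using openin_proj_space_coords[of "{k}" "flag k"] by (simp add: lines_flag)

lemma openin_proj_Q:
  "openin (proj_space smul Q) U \<longleftrightarrow> U \<subseteq> (\<Union>k. line ` nonzero_coords k) \<and>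
     (\<forall>k. openin (top_of_set (nonzero_coords k)) {x \<in> nonzero_coords k. line x \<in> U})"
proof -
  have "flag k \<subseteq> Q" for k unfolding Q_eq_Union_flag by blast
  moreover have "\<exists>k\<in>UNIV. V \<subseteq> flag k" if "V \<subseteq> Q" "finite_dim_module smul V" for V
    using finite_dim_in_flag that by blast
  ultimately show ?thesis
    using openin_proj_space_coords[of UNIV Q U] by (simp add: lines_Q)
qed

lemma topspace_proj_flag [simp]: "topspace (proj_space smul (flag k)) = line ` nonzero_coords k"
proof -
  have "{x \<in> nonzero_coords k. line x \<in> line ` nonzero_coords k} = nonzero_coords k" by blast
  then have "openin (proj_space smul (flag k)) (line ` nonzero_coords k)"
    by (simp add: openin_proj_flag)
  moreover have "topspace (proj_space smul (flag k)) \<subseteq> line ` nonzero_coords k"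
    using openin_proj_flag[of k "topspace (proj_space smul (flag k))"] by simp
  ultimately show ?thesis by (intro subset_antisym openin_subset)
qed

lemma topspace_proj_Q [simp]: "topspace (proj_space smul Q) = (\<Union>k. line ` nonzero_coords k)"
proof -
  have "{x \<in> nonzero_coords k. line x \<in> (\<Union>k. line ` nonzero_coords k)} = nonzero_coords k" for k by blast
  then have "openin (proj_space smul Q) (\<Union>k. line ` nonzero_coords k)"
    by (simp add: openin_proj_Q)
  moreover have "topspace (proj_space smul Q) \<subseteq> (\<Union>k. line ` nonzero_coords k)"
    using openin_proj_Q[of "topspace (proj_space smul Q)"] by simp
  ultimately show ?thesis by (intro subset_antisym openin_subset)
qed

lemma quotient_map_line:
  "quotient_map (top_of_set (nonzero_coords k)) (proj_space smul (flag k)) line"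
  by (auto simp: quotient_map_def openin_proj_flag)

text \<open>A closed set in a stage remains closed in the whole space: \<open>coord_space k\<close> is closed in
  \<open>coord_space l\<close>, and lines of the smaller stage have no spanning vectors outside of it. So an open
  set \<open>U\<close> of the stage is the trace of the complement of (stage minus \<open>U\<close>).\<close>

lemma proj_flag_subspace:
  "proj_space smul (flag k) = subtopology (proj_space smul Q) (line ` nonzero_coords k)"
  unfolding topology_eq
proof (intro allI iffI)
  fix U assume U: "openin (proj_space smul (flag k)) U"
  obtain O' where O': "open O'" "{x \<in> nonzero_coords k. line x \<in> U} = nonzero_coords k \<inter> O'"
    using U by (auto simp: openin_proj_flag openin_open)
  \<comment> \<open>the largest set of lines with trace \<open>U\<close>\<close>
  define T where "T = topspace (proj_space smul Q) - (line ` nonzero_coords k - U)"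
  have "openin (top_of_set (nonzero_coords l)) {x \<in> nonzero_coords l. line x \<in> T}" for l
  proof -
    have "line x \<in> T \<longleftrightarrow> x \<notin> coord_space k \<or> x \<in> O'" if "x \<in> nonzero_coords l" for x
    proof -
      have "x \<in> coord_space k \<longleftrightarrow> x \<in> nonzero_coords k"
        using that by (auto simp: nonzero_coords_def)
      moreover have "line x \<in> T \<longleftrightarrow> \<not> (x \<in> nonzero_coords k \<and> line x \<notin> U)"
        using that line_in_image_iff[OF that] by (auto simp: T_def)
      ultimately show ?thesis using O'(2) by blast
    qed
    then have "{x \<in> nonzero_coords l. line x \<in> T} = nonzero_coords l \<inter> (- coord_space k \<union> O')"
      by blast
    then show ?thesis
      using O'(1) closed_coord_space[of k] by (simp add: openin_open_Int open_Un open_Compl)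
  qed
  then have "openin (proj_space smul Q) T"
    by (auto simp: openin_proj_Q T_def)
  moreover have "U = T \<inter> line ` nonzero_coords k"
    using U by (auto simp: T_def openin_proj_flag)
  ultimately show "openin (subtopology (proj_space smul Q) (line ` nonzero_coords k)) U"
    by (auto simp: openin_subtopology)
next
  fix U assume "openin (subtopology (proj_space smul Q) (line ` nonzero_coords k)) U"
  then obtain T where T: "openin (proj_space smul Q) T" "U = T \<inter> line ` nonzero_coords k"
    by (auto simp: openin_subtopology)
  then have "{x \<in> nonzero_coords k. line x \<in> U} = {x \<in> nonzero_coords k. line x \<in> T}" by auto
  then show "openin (proj_space smul (flag k)) U"
    using T by (auto simp: openin_proj_flag openin_proj_Q)
qed

lemma openin_proj_Q_iff_flags:
  assumes "U \<subseteq> topspace (proj_space smul Q)"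
  shows "openin (proj_space smul Q) U \<longleftrightarrow>
    (\<forall>m. openin (proj_space smul (flag (Suc m))) (U \<inter> line ` nonzero_coords (Suc m)))"
proof -
  have "{x \<in> nonzero_coords k. line x \<in> U \<inter> line ` nonzero_coords k} = {x \<in> nonzero_coords k. line x \<in> U}" for k
    by blast
  then have "openin (proj_space smul (flag k)) (U \<inter> line ` nonzero_coords k) \<longleftrightarrow>
      openin (top_of_set (nonzero_coords k)) {x \<in> nonzero_coords k. line x \<in> U}" for k
    by (simp add: openin_proj_flag)
  \<comment> \<open>the stage without homogeneous coordinates is empty, so it can be left out\<close>
  moreover have "nonzero_coords 0 = {}"
    by (auto simp: nonzero_coords_def coord_space_def)
  then have "openin (top_of_set (nonzero_coords 0)) {x \<in> nonzero_coords 0. line x \<in> U}"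
    by simp
  then have "openin (top_of_set (nonzero_coords k)) {x \<in> nonzero_coords k. line x \<in> U}"
    if "\<forall>m. openin (top_of_set (nonzero_coords (Suc m))) {x \<in> nonzero_coords (Suc m). line x \<in> U}" for k
    using that by (cases k) simp_all
  moreover have "U \<subseteq> (\<Union>k. line ` nonzero_coords k)"
    using assms by simp
  ultimately show ?thesis
    unfolding openin_proj_Q by blast
qed

end


section \<open>The action on projective space\<close>

text \<open>The action that makes the \<open>i\<close>-th basis vector span a copy of \<open>\<Psi>\<^sub>i\<close>. In
  coordinates the power of \<open>\<zeta>\<close> stands on the right, since scalars act from the left.\<close>

locale coordinates_action = coordinates smul Q vec
  for smul :: "quat \<Rightarrow> 'q::ab_group_add \<Rightarrow> 'q" and Q :: "'q set" and vec :: "(nat \<Rightarrow> quat) \<Rightarrow> 'q" +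
  fixes n :: nat and act :: "int \<Rightarrow> 'q \<Rightarrow> 'q"
  assumes n_pos: "n \<ge> 1"
    and act_vec: "g \<in> carrier (integer_mod_group n) \<Longrightarrow> x \<in> fin_coords \<Longrightarrow>
      act g (vec x) = vec (\<lambda>i. x i * root_power n (int i * g))"
begin

definition coord_act :: "int \<Rightarrow> (nat \<Rightarrow> quat) \<Rightarrow> nat \<Rightarrow> quat" where
  "coord_act g x = (\<lambda>i. x i * root_power n (int i * g))"

lemma coord_act_coord_space: "x \<in> coord_space k \<Longrightarrow> coord_act g x \<in> coord_space k"
  by (simp add: coord_space_def coord_act_def)

lemma coord_act_nonzero: "x \<in> nonzero_coords k \<Longrightarrow> coord_act g x \<in> nonzero_coords k"
  by (auto simp: nonzero_coords_def coord_act_coord_space) (auto simp: coord_act_def fun_eq_iff)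

lemma continuous_coord_act: "continuous_on S (coord_act g)"
  unfolding coord_act_def
  by (intro continuous_intros continuous_on_subset[OF continuous_on_product_coordinates]) auto

lemma act_image_line:
  assumes "g \<in> carrier (integer_mod_group n)" "x \<in> fin_coords"
  shows "act g ` line x = line (coord_act g x)"
proof -
  have "coord_act g x \<in> fin_coords"
    using fin_mult[OF assms(2), of 1] by (simp add: coord_act_def)
  moreover have "act g (vec (\<lambda>i. l * x i)) = vec (\<lambda>i. l * coord_act g x i)" for l
    using act_vec[OF assms(1) fin_smul[OF assms(2)]] by (simp add: coord_act_def mult.assoc)
  ultimately show ?thesis
    unfolding line_eq_image[OF assms(2)] by (simp add: line_eq_image setcompr_eq_image image_image)
qed

lemma act_line_nonzero:
  assumes "g \<in> carrier (integer_mod_group n)" "x \<in> nonzero_coords k"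
  shows "act g ` line x = line (coord_act g x)"
  using act_image_line assms nonzero_subset_fin by blast

lemma act_invariant_flag:
  "g \<in> carrier (integer_mod_group n) \<Longrightarrow>
     (\<lambda>p. act g ` p) ` (line ` nonzero_coords k) \<subseteq> line ` nonzero_coords k"
  using act_line_nonzero coord_act_nonzero by fastforce

lemma root_power_mod: "root_power n (i * (a mod int n)) = root_power n (i * a)"
proof (rule root_power_cong[OF n_pos])
  have "i * (a mod int n) - i * a = - (i * (a - a mod int n))" by (simp add: algebra_simps)
  then show "int n dvd i * (a mod int n) - i * a"
    by (simp add: dvd_mult flip: mod_eq_dvd_iff)
qed

lemma gspace_proj_Q: "gspace (integer_mod_group n) (proj_space smul Q) (\<lambda>g. image (act g))"
  unfolding gspace_def
proof (intro conjI ballI)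
  fix g assume g: "g \<in> carrier (integer_mod_group n)"
  show "continuous_map (proj_space smul Q) (proj_space smul Q) (image (act g))"
    unfolding continuous_map_def
  proof (intro conjI allI impI)
    show "image (act g) \<in> topspace (proj_space smul Q) \<rightarrow> topspace (proj_space smul Q)"
      using act_invariant_flag[OF g] by fastforce
    fix U assume U: "openin (proj_space smul Q) U"
    let ?V = "{p \<in> topspace (proj_space smul Q). act g ` p \<in> U}"
    have "openin (top_of_set (nonzero_coords k)) {x \<in> nonzero_coords k. line x \<in> ?V}" for k
    proof -
      have "{x \<in> nonzero_coords k. line x \<in> ?V}
          = {x \<in> topspace (top_of_set (nonzero_coords k)). coord_act g x \<in> {x \<in> nonzero_coords k. line x \<in> U}}"
        using act_line_nonzero[OF g] coord_act_nonzero by auto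
      moreover have "continuous_map (top_of_set (nonzero_coords k)) (top_of_set (nonzero_coords k)) (coord_act g)"
        using continuous_coord_act coord_act_nonzero by auto
      moreover have "openin (top_of_set (nonzero_coords k)) {x \<in> nonzero_coords k. line x \<in> U}"
        using U unfolding openin_proj_Q by blast
      ultimately show ?thesis
        by (simp only: openin_continuous_map_preimage)
    qed
    then show "openin (proj_space smul Q) ?V"
      by (auto simp: openin_proj_Q)
  qed
next
  fix p assume "p \<in> topspace (proj_space smul Q)"
  then obtain k x where x: "x \<in> nonzero_coords k" "p = line x" by auto
  have one: "coord_act 0 x = x" by (simp add: coord_act_def)
  show "act \<one>\<^bsub>integer_mod_group n\<^esub> ` p = p"
    using act_line_nonzero[OF integer_mod_group_0 x(1)] x(2) one by simp
  fix g h assume gh: "g \<in> carrier (integer_mod_group n)" "h \<in> carrier (integer_mod_group n)"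
  have "g \<otimes>\<^bsub>integer_mod_group n\<^esub> h \<in> carrier (integer_mod_group n)"
    using gh group.subgroup_self[OF group_integer_mod_group] subgroup.m_closed by metis
  moreover have "coord_act (g \<otimes>\<^bsub>integer_mod_group n\<^esub> h) x = coord_act g (coord_act h x)"
    by (simp add: coord_act_def root_power_mod distrib_left root_power_add mult.assoc root_power_commute)
  ultimately show "act (g \<otimes>\<^bsub>integer_mod_group n\<^esub> h) ` p = act g ` act h ` p"
    using act_line_nonzero x gh coord_act_nonzero by metis
qed

end


section \<open>Attaching one cell with full isotropy group\<close>

text \<open>The preimage of an open set is the union of its slices over the points of the discrete factor,
  and these points are open.\<close>

lemma continuous_map_prod_discrete:
  assumes "\<And>g. g \<in> C \<Longrightarrow> continuous_map X Y (\<lambda>v. f (g, v))"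
  shows "continuous_map (prod_topology (discrete_topology C) X) Y f"
  unfolding continuous_map_def
proof (intro conjI allI impI)
  show "f \<in> topspace (prod_topology (discrete_topology C) X) \<rightarrow> topspace Y"
    using continuous_map_image_subset_topspace[OF assms] by fastforce
  fix U assume U: "openin Y U"
  have "{p \<in> topspace (prod_topology (discrete_topology C) X). f p \<in> U}
      = (\<Union>g\<in>C. {g} \<times> {v \<in> topspace X. f (g, v) \<in> U})" by auto
  moreover have "openin (prod_topology (discrete_topology C) X) ({g} \<times> {v \<in> topspace X. f (g, v) \<in> U})"
    if "g \<in> C" for g
    using openin_continuous_map_preimage[OF assms[OF that] U] that by (simp add: openin_prod_Times_iff)
  ultimately show "openin (prod_topology (discrete_topology C) X)
      {p \<in> topspace (prod_topology (discrete_topology C) X). f p \<in> U}"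
    by auto
qed

text \<open>A representation of the whole group \<open>G\<close>. Every class in \<open>G \<times>\<^sub>G A\<close> then has exactly one
  representative whose group component is the unit, and \<open>base_vector\<close> extracts its vector. This
  identifies the induced space with \<open>A\<close>, so the cells below are ordinary disks.\<close>

locale full_rep = group G for G (structure) +
  fixes R :: "('g, 'v::real_normed_vector, 'z) real_rep_scheme"
  assumes rep: "is_real_rep G R" and full: "rgroup R = carrier G"
    and continuous_ract: "g \<in> carrier G \<Longrightarrow> continuous_on (rspace R) (ract R g)"
begin

definition base_vector :: "('g \<times> 'v) set \<Rightarrow> 'v" where
  "base_vector c = (THE v. (\<one>, v) \<in> c)"

lemma ract_closed: "g \<in> carrier G \<Longrightarrow> v \<in> rspace R \<Longrightarrow> ract R g v \<in> rspace R"
  and ract_one: "v \<in> rspace R \<Longrightarrow> ract R \<one> v = v"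
  and ract_mult: "g \<in> carrier G \<Longrightarrow> h \<in> carrier G \<Longrightarrow> v \<in> rspace R \<Longrightarrow>
    ract R (g \<otimes> h) v = ract R g (ract R h v)"
  and rinner_ract: "g \<in> carrier G \<Longrightarrow> v \<in> rspace R \<Longrightarrow> w \<in> rspace R \<Longrightarrow>
    rinner R (ract R g v) (ract R g w) = rinner R v w"
  using rep by (simp_all add: is_real_rep_def Let_def full)

lemma induced_class_eq:
  assumes "g \<in> carrier G" "v \<in> rspace R"
  shows "induced_class G R (g, v) = induced_class G R (\<one>, ract R g v)"
proof -
  have "\<exists>k'\<in>carrier G. (g \<otimes> k, ract R (inv k) v) = (\<one> \<otimes> k', ract R (inv k') (ract R g v))"
    if "k \<in> carrier G" for k
    using that assms by (intro bexI[of _ "g \<otimes> k"]) (simp_all add: inv_mult_group m_assoc flip: ract_mult)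
  moreover have "\<exists>k\<in>carrier G. (\<one> \<otimes> k', ract R (inv k') (ract R g v)) = (g \<otimes> k, ract R (inv k) v)"
    if "k' \<in> carrier G" for k'
    using that assms
    by (intro bexI[of _ "inv g \<otimes> k'"]) (simp_all add: inv_mult_group flip: m_assoc ract_mult)
  ultimately show ?thesis
    unfolding induced_class_def full by (simp only: prod.case) blast
qed

lemma base_vector_class:
  assumes "g \<in> carrier G" "v \<in> rspace R"
  shows "base_vector (induced_class G R (g, v)) = ract R g v"
proof -
  have v: "ract R g v \<in> rspace R" using ract_closed assms by blast
  have "(\<one>, u) \<in> induced_class G R (\<one>, ract R g v) \<longleftrightarrow> u = ract R g v" for u
  proof
    assume "(\<one>, u) \<in> induced_class G R (\<one>, ract R g v)"
    then obtain k where "k \<in> carrier G" "\<one> = \<one> \<otimes> k" "u = ract R (inv k) (ract R g v)"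
      by (auto simp: induced_class_def full)
    then show "u = ract R g v" using ract_one[OF v] by (metis inv_one l_one)
  next
    assume "u = ract R g v"
    then have "(\<one>, u) = (\<one> \<otimes> \<one>, ract R (inv \<one>) (ract R g v))" using ract_one[OF v] by simp
    then show "(\<one>, u) \<in> induced_class G R (\<one>, ract R g v)"
      unfolding induced_class_def full by blast
  qed
  then show ?thesis
    unfolding base_vector_def induced_class_eq[OF assms] by simp
qed

lemma induced_act_class:
  assumes "g \<in> carrier G" "h \<in> carrier G"
  shows "induced_act G h (induced_class G R (g, v)) = induced_class G R (h \<otimes> g, v)"
  using assms by (force simp: induced_act_def induced_class_def full m_assoc image_iff)

lemma topspace_induced_space:
  "topspace (induced_space G R (top_of_set A)) = induced_class G R ` (carrier G \<times> A)"
  by (simp add: induced_space_def)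

lemma induced_space_cases:
  assumes "p \<in> topspace (induced_space G R (top_of_set A))" "A \<subseteq> rspace R"
    and "\<And>g v. g \<in> carrier G \<Longrightarrow> v \<in> A \<Longrightarrow> ract R g v \<in> A"
  obtains v where "v \<in> A" "p = induced_class G R (\<one>, v)" "base_vector p = v"
proof -
  obtain g v where gv: "g \<in> carrier G" "v \<in> A" "p = induced_class G R (g, v)"
    using assms(1) by (auto simp: topspace_induced_space)
  then have "p = induced_class G R (\<one>, ract R g v)" "base_vector p = ract R g v"
    using induced_class_eq base_vector_class assms(2) by blast+
  then show thesis using that assms(3) gv by blast
qed

lemma base_vector_one: "v \<in> rspace R \<Longrightarrow> base_vector (induced_class G R (\<one>, v)) = v"
  using base_vector_class[OF one_closed] ract_one by simp

lemma induced_act_one: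
  assumes "h \<in> carrier G" "v \<in> rspace R"
  shows "induced_act G h (induced_class G R (\<one>, v)) = induced_class G R (\<one>, ract R h v)"
  using induced_act_class[OF one_closed assms(1)] induced_class_eq[OF assms] assms(1) by simp

lemma continuous_map_base_vector:
  assumes "A \<subseteq> rspace R" and inv: "\<And>g v. g \<in> carrier G \<Longrightarrow> v \<in> A \<Longrightarrow> ract R g v \<in> A"
  shows "continuous_map (induced_space G R (top_of_set A)) (top_of_set A) base_vector"
  unfolding induced_space_def
proof (rule continuous_compose_quotient_map[OF quotient_map_quotient_topology])
  let ?P = "prod_topology (discrete_topology (carrier G)) (top_of_set A)"
  have "continuous_map ?P (top_of_set A) (\<lambda>(g, v). ract R g v)"
    using continuous_on_subset[OF continuous_ract assms(1)] inv
    by (intro continuous_map_prod_discrete) (auto simp: continuous_map_in_subtopology)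
  then show "continuous_map ?P (top_of_set A) (base_vector \<circ> induced_class G R)"
    by (rule continuous_map_eq) (use base_vector_class assms(1) in auto)
qed

lemma continuous_map_class:
  "continuous_map (top_of_set A) (induced_space G R (top_of_set A)) (\<lambda>v. induced_class G R (\<one>, v))"
proof -
  have "continuous_map (top_of_set A) (prod_topology (discrete_topology (carrier G)) (top_of_set A)) (\<lambda>v. (\<one>, v))"
    by (simp add: continuous_map_pairwise o_def)
  then show ?thesis
    using continuous_map_compose quotient_imp_continuous_map[OF quotient_map_quotient_topology]
    unfolding induced_space_def o_def by blast
qed

end

text \<open>A criterion that refers only to the disk \<open>D\<close> and a characteristic map \<open>\<psi>\<close> on it. The equivalence
  relation of the adjunction space has a normal form: a point of the
  disjoint union is equivalent to a point of \<open>X\<close>, or it is an interior point of the disk. The map into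
  \<open>Y\<close> separates these normal forms by the assumptions \<open>boundary\<close> and \<open>interior\<close>, and it is
  constant on equivalence classes because \<open>\<psi>\<close> restricts to the attaching map.\<close>

lemma attach_single_cell:
  fixes c :: "('g, 'v::real_normed_vector, 'x) cell" and \<psi> :: "'v \<Rightarrow> 'x"
  assumes "full_rep G c"
  defines "D \<equiv> {v \<in> rspace c. rinner c v v \<le> 1}" and "S \<equiv> {v \<in> rspace c. rinner c v v = 1}"
  assumes X: "X = subtopology Y (topspace X)" "topspace X \<subseteq> topspace Y"
    and cont: "continuous_map (top_of_set D) Y \<psi>"
    and open_Y: "\<And>U. U \<subseteq> topspace Y \<Longrightarrow> openin X (U \<inter> topspace X) \<Longrightarrow>
      openin (top_of_set D) {v \<in> D. \<psi> v \<in> U} \<Longrightarrow> openin Y U"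
    and cover: "topspace Y \<subseteq> topspace X \<union> \<psi> ` D"
    and boundary: "\<And>v. v \<in> D \<Longrightarrow> \<psi> v \<in> topspace X \<longleftrightarrow> v \<in> S"
    and interior: "\<And>v w. v \<in> D - S \<Longrightarrow> w \<in> D - S \<Longrightarrow> \<psi> v = \<psi> w \<Longrightarrow> v = w"
    and equivariant: "\<And>g v. g \<in> carrier G \<Longrightarrow> v \<in> D \<Longrightarrow> \<psi> (ract c g v) = \<alpha> g (\<psi> v)"
    and attach: "cattach c = \<psi> \<circ> full_rep.base_vector G"
  shows "attach_cells G \<alpha> X Y {0::nat} (\<lambda>_. c)"
proof -
  interpret full_rep G c by fact
  define Z where "Z = sum_topology (\<lambda>_::nat. induced_space G c (top_of_set D)) {0}"
  define \<Phi> where "\<Phi> = (\<lambda>(i::nat, p). \<psi> (base_vector p))"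
  have disk: "unit_disk c = top_of_set D" and sphere: "unit_sphere c = top_of_set S"
    by (simp_all add: unit_disk_def unit_sphere_def D_def S_def)
  \<comment> \<open>disk and sphere are invariant since the action is orthogonal\<close>
  have D: "D \<subseteq> rspace c" "\<And>g v. g \<in> carrier G \<Longrightarrow> v \<in> D \<Longrightarrow> ract c g v \<in> D"
    and S: "S \<subseteq> rspace c" "\<And>g v. g \<in> carrier G \<Longrightarrow> v \<in> S \<Longrightarrow> ract c g v \<in> S" "S \<subseteq> D"
    using ract_closed rinner_ract by (auto simp: D_def S_def)
  have SX: "continuous_map (top_of_set S) X \<psi>"
  proof -
    have "continuous_map (top_of_set S) Y \<psi>"
      using cont S(3) continuous_map_from_subtopology_mono by blast
    then have "continuous_map (top_of_set S) (subtopology Y (topspace X)) \<psi>"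
      using boundary S(3) by (auto simp: continuous_map_in_subtopology)
    then show ?thesis using X(1) by simp
  qed
  have top_Z: "topspace Z = {0} \<times> topspace (induced_space G c (top_of_set D))"
    by (auto simp: Z_def)
  have Z_cases: "\<exists>v\<in>D. z = (0, induced_class G c (\<one>\<^bsub>G\<^esub>, v)) \<and> \<Phi> z = \<psi> v" if z: "z \<in> topspace Z" for z
  proof -
    obtain p where p: "z = (0, p)" "p \<in> topspace (induced_space G c (top_of_set D))"
      using z unfolding top_Z by blast
    show ?thesis
      using induced_space_cases[OF p(2) D] p(1) by (metis \<Phi>_def case_prod_conv)
  qed
  have class_Z: "(0, induced_class G c (\<one>\<^bsub>G\<^esub>, v)) \<in> topspace Z"
    "\<Phi> (0, induced_class G c (\<one>\<^bsub>G\<^esub>, v)) = \<psi> v" if "v \<in> D" for v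
    using that D(1) base_vector_one by (auto simp: top_Z topspace_induced_space \<Phi>_def)
  have cont_\<Phi>: "continuous_map Z Y \<Phi>"
    unfolding continuous_map_def
  proof (intro conjI allI impI)
    show "\<Phi> \<in> topspace Z \<rightarrow> topspace Y"
      using Z_cases continuous_map_image_subset_topspace[OF cont] by fastforce
    fix U assume U: "openin Y U"
    have "continuous_map (induced_space G c (top_of_set D)) Y (\<psi> \<circ> base_vector)"
      by (rule continuous_map_compose[OF continuous_map_base_vector[OF D] cont])
    from openin_continuous_map_preimage[OF this U]
    show "openin Z {z \<in> topspace Z. \<Phi> z \<in> U}"
      by (auto simp: Z_def openin_sum_topology \<Phi>_def)
  qed
  have quot: "quotient_map (coprod_topology X Z) Y (case_sum id \<Phi>)"
    unfolding quotient_map_def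
  proof (intro conjI allI impI)
    have "\<psi> v \<in> case_sum id \<Phi> ` (topspace X <+> topspace Z)" if "v \<in> D" for v
      using class_Z[OF that] by (metis InrI image_eqI old.sum.simps(6))
    moreover have "x \<in> case_sum id \<Phi> ` (topspace X <+> topspace Z)" if "x \<in> topspace X" for x
      using that by (intro image_eqI[of _ _ "Inl x"]) auto
    ultimately have "topspace Y \<subseteq> case_sum id \<Phi> ` (topspace X <+> topspace Z)"
      using cover by blast
    then show "case_sum id \<Phi> ` topspace (coprod_topology X Z) = topspace Y"
      using X(2) continuous_map_image_subset_topspace[OF cont_\<Phi>] by auto
    fix U assume U: "U \<subseteq> topspace Y"
    let ?V = "{p \<in> topspace (coprod_topology X Z). case_sum id \<Phi> p \<in> U}"
    have V: "Inl -` ?V = U \<inter> topspace X" "Inr -` ?V = {z \<in> topspace Z. \<Phi> z \<in> U}"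
      by auto
    then have open_V: "openin (coprod_topology X Z) ?V \<longleftrightarrow>
        openin X (U \<inter> topspace X) \<and> openin Z {z \<in> topspace Z. \<Phi> z \<in> U}"
      unfolding openin_coprod_topology V by auto
    show "openin (coprod_topology X Z) ?V \<longleftrightarrow> openin Y U"
    proof
      assume "openin (coprod_topology X Z) ?V"
      then have o: "openin X (U \<inter> topspace X)" "openin Z {z \<in> topspace Z. \<Phi> z \<in> U}"
        using open_V by auto
      have "openin (induced_space G c (top_of_set D)) {p. (0, p) \<in> {z \<in> topspace Z. \<Phi> z \<in> U}}"
        using o(2) unfolding Z_def openin_sum_topology by simp
      from openin_continuous_map_preimage[OF continuous_map_class this]
      have "openin (top_of_set D)
          {v \<in> D. (0, induced_class G c (\<one>\<^bsub>G\<^esub>, v)) \<in> {z \<in> topspace Z. \<Phi> z \<in> U}}"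
        by simp
      moreover have "{v \<in> D. (0, induced_class G c (\<one>\<^bsub>G\<^esub>, v)) \<in> {z \<in> topspace Z. \<Phi> z \<in> U}}
          = {v \<in> D. \<psi> v \<in> U}"
        using class_Z by auto
      ultimately show "openin Y U" using open_Y[OF U o(1)] by simp
    next
      assume o: "openin Y U"
      have "openin X (U \<inter> topspace X)"
        by (subst X(1)) (use o in \<open>auto simp: openin_subtopology\<close>)
      then show "openin (coprod_topology X Z) ?V"
        using open_V openin_continuous_map_preimage[OF cont_\<Phi> o] by simp
    qed
  qed
  define B where "B = (SIGMA i:{0::nat}. topspace (induced_space G c (top_of_set S)))"
  define rel :: "'x + nat \<times> ('g \<times> 'v) set \<Rightarrow> 'x + nat \<times> ('g \<times> 'v) set \<Rightarrow> bool"
    where "rel = (\<lambda>u v. \<exists>z\<in>B. u = Inr z \<and> v = Inl ((\<lambda>(i, p). cattach c p) z))"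
  have B_iff: "(0, induced_class G c (\<one>\<^bsub>G\<^esub>, v)) \<in> B" if "v \<in> S" for v
    using that by (auto simp: B_def topspace_induced_space)
  have rel_\<Phi>: "case_sum id \<Phi> u = case_sum id \<Phi> v" if "rel u v" for u v
    using that by (auto simp: rel_def attach \<Phi>_def)
  have rel_sphere: "equivclp rel (Inr (0, induced_class G c (\<one>\<^bsub>G\<^esub>, v))) (Inl (\<psi> v))" if "v \<in> S" for v
  proof -
    have "cattach c (induced_class G c (\<one>\<^bsub>G\<^esub>, v)) = \<psi> v"
      using that S(1) base_vector_one by (auto simp: attach)
    then have "rel (Inr (0, induced_class G c (\<one>\<^bsub>G\<^esub>, v))) (Inl (\<psi> v))"
      using B_iff[OF that] unfolding rel_def by force
    then show ?thesis by blast
  qed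
  \<comment> \<open>every point is equivalent to a point of \<open>X\<close> or lies in the open cell\<close>
  have to_normal: "(\<exists>x\<in>topspace X. equivclp rel p (Inl x) \<and> case_sum id \<Phi> p = x) \<or>
      (\<exists>v\<in>D - S. p = Inr (0, induced_class G c (\<one>\<^bsub>G\<^esub>, v)) \<and> case_sum id \<Phi> p = \<psi> v)"
    if "p \<in> topspace X <+> topspace Z" for p
  proof (cases p)
    case (Inl x)
    then show ?thesis using that by (intro disjI1 bexI[of _ x]) auto
  next
    case (Inr z)
    then have "z \<in> topspace Z"
      using that by auto
    then obtain v where v: "v \<in> D" "z = (0, induced_class G c (\<one>\<^bsub>G\<^esub>, v))" "\<Phi> z = \<psi> v"
      using Z_cases by blast
    then show ?thesis using Inr rel_sphere boundary[OF v(1)] by (cases "v \<in> S") auto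
  qed
  have equiv: "case_sum id \<Phi> p = case_sum id \<Phi> q \<longleftrightarrow> equivclp rel p q"
    if "p \<in> topspace X <+> topspace Z" "q \<in> topspace X <+> topspace Z" for p q
  proof
    assume "equivclp rel p q"
    then show "case_sum id \<Phi> p = case_sum id \<Phi> q"
      by (induction rule: equivclp_induct) (use rel_\<Phi> in force)+
  next
    assume eq: "case_sum id \<Phi> p = case_sum id \<Phi> q"
    have no: "x \<noteq> \<psi> v" if "x \<in> topspace X" "v \<in> D - S" for x v
      using that boundary by auto
    from to_normal[OF that(1)] show "equivclp rel p q"
    proof
      assume "\<exists>x\<in>topspace X. equivclp rel p (Inl x) \<and> case_sum id \<Phi> p = x"
      then obtain x where x: "x \<in> topspace X" "equivclp rel p (Inl x)" "case_sum id \<Phi> p = x" by blast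
      then have "equivclp rel q (Inl x)"
        using to_normal[OF that(2)] eq no by auto
      then show ?thesis using x(2) equivclp_trans equivclp_sym by metis
    next
      assume "\<exists>v\<in>D - S. p = Inr (0, induced_class G c (\<one>\<^bsub>G\<^esub>, v)) \<and> case_sum id \<Phi> p = \<psi> v"
      then have "p = q"
        using to_normal[OF that(2)] eq no interior by metis
      then show ?thesis by simp
    qed
  qed
  have "adjunction_space X Z B (\<lambda>(i, p). cattach c p) Y \<Phi>"
    unfolding adjunction_space_def using quot equiv unfolding rel_def by blast
  moreover have "\<Phi> (i, induced_act G g p) = \<alpha> g (\<Phi> (i, p))"
    if "g \<in> carrier G" and p: "p \<in> topspace (induced_space G c (top_of_set D))" for i g p
  proof -
    obtain v where v: "v \<in> D" "p = induced_class G c (\<one>\<^bsub>G\<^esub>, v)" "base_vector p = v"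
      using induced_space_cases[OF p D] by blast
    then have "base_vector (induced_act G g p) = ract c g v"
      using induced_act_one[OF that(1)] base_vector_one ract_closed[OF that(1)] subsetD[OF D(1) v(1)] by simp
    then show ?thesis using v equivariant[OF that(1) v(1)] by (simp add: \<Phi>_def)
  qed
  moreover have "continuous_map (induced_space G c (unit_sphere c)) X (cattach c)"
    unfolding attach sphere by (rule continuous_map_compose[OF continuous_map_base_vector[OF S(1,2)] SX])
  moreover have "cattach c (induced_act G g p) = \<alpha> g (cattach c p)"
    if "g \<in> carrier G" and p: "p \<in> topspace (induced_space G c (unit_sphere c))" for g p
  proof -
    obtain v where v: "v \<in> S" "p = induced_class G c (\<one>\<^bsub>G\<^esub>, v)" "base_vector p = v"
      using induced_space_cases[OF p[unfolded sphere] S(1,2)] by blast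
    then have "base_vector (induced_act G g p) = ract c g v"
      using induced_act_one[OF that(1)] base_vector_one ract_closed[OF that(1)] subsetD[OF S(1) v(1)] by simp
    then show ?thesis using v equivariant[OF that(1)] S(3) by (auto simp: attach)
  qed
  ultimately show ?thesis
    unfolding attach_cells_def using rep by (auto simp: disk sphere Z_def B_def)
qed


section \<open>Continuity of quaternion components\<close>

lemma bounded_linear_Quat: "bounded_linear (\<lambda>p. Quat (fst p) (snd p))"
  by (rule bounded_linear_intro[where K = 1])
    (auto simp: quat_simps quat_norm_Pair)

lemma continuous_on_Quat [continuous_intros]:
  "continuous_on S f \<Longrightarrow> continuous_on S g \<Longrightarrow> continuous_on S (\<lambda>x. Quat (f x) (g x))"
  using bounded_linear.continuous_on[OF bounded_linear_Quat continuous_on_Pair[of S f g]] by simp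

lemma compact_unit_quats: "compact {q::quat. norm q = 1}"
proof -
  have "{q::quat. norm q = 1} = (\<lambda>p. Quat (fst p) (snd p)) ` sphere 0 1"
  proof (intro subset_antisym subsetI)
    fix q :: quat assume "q \<in> {q. norm q = 1}"
    then have "q = Quat (fst (qfst q, qsnd q)) (snd (qfst q, qsnd q))" "(qfst q, qsnd q) \<in> sphere 0 1"
      by (simp_all add: quat_norm_Pair)
    then show "q \<in> (\<lambda>p. Quat (fst p) (snd p)) ` sphere 0 1" by blast
  qed (auto simp: quat_norm_Pair)
  moreover have "continuous_on (sphere 0 1) (\<lambda>p. Quat (fst p) (snd p))"
    by (intro continuous_intros)
  ultimately show ?thesis
    using compact_continuous_image compact_sphere by metis
qed


section \<open>Finitely supported real sequences\<close>

lemma lookup_scaleR [simp]: "Poly_Mapping.lookup (r *\<^sub>R x) i = r *\<^sub>R Poly_Mapping.lookup x i"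
  by (simp add: scaleR_poly_mapping_def)

lemma bounded_linear_lookup: "bounded_linear (\<lambda>v::'a \<Rightarrow>\<^sub>0 real. Poly_Mapping.lookup v i)"
proof (rule bounded_linear_intro[where K = 1])
  fix v :: "'a \<Rightarrow>\<^sub>0 real"
  have "norm v = (\<Sum>i\<in>Poly_Mapping.keys v. \<bar>Poly_Mapping.lookup v i\<bar>)"
    by (simp add: norm_poly_mapping_def dist_poly_mapping_def)
  moreover have "\<bar>Poly_Mapping.lookup v i\<bar> \<le> (\<Sum>i\<in>Poly_Mapping.keys v. \<bar>Poly_Mapping.lookup v i\<bar>)"
    by (cases "i \<in> Poly_Mapping.keys v") (auto intro: member_le_sum sum_nonneg simp: in_keys_iff)
  ultimately show "norm (Poly_Mapping.lookup v i) \<le> norm v * 1" by simp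
qed (simp_all add: lookup_add)

lemma continuous_on_lookup [continuous_intros]:
  "continuous_on S f \<Longrightarrow> continuous_on S (\<lambda>x. Poly_Mapping.lookup (f x) i :: real)"
  by (rule bounded_linear.continuous_on[OF bounded_linear_lookup])

lemma single_scaleR_one: "Poly_Mapping.single j r = r *\<^sub>R Poly_Mapping.single j (1::real)"
  by (rule poly_mapping_eqI) (simp add: lookup_single when_def)

lemma continuous_on_single [continuous_intros]:
  "continuous_on S f \<Longrightarrow> continuous_on S (\<lambda>x. Poly_Mapping.single j (f x :: real))"
  by (subst single_scaleR_one) (intro continuous_intros)

lemma span_singles:
  assumes "finite J"
  shows "span ((\<lambda>j. Poly_Mapping.single j (1::real)) ` J) = {v. Poly_Mapping.keys v \<subseteq> J}"
proof (intro subset_antisym subsetI)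
  fix v :: "'a \<Rightarrow>\<^sub>0 real" assume v: "v \<in> {v. Poly_Mapping.keys v \<subseteq> J}"
  have "v = (\<Sum>j\<in>Poly_Mapping.keys v. Poly_Mapping.lookup v j *\<^sub>R Poly_Mapping.single j 1)"
    by (rule poly_mapping_eqI) (simp add: lookup_sum lookup_single when_def in_keys_iff if_distrib[of "(*) _"] cong: if_cong)
  moreover have "(\<Sum>j\<in>Poly_Mapping.keys v. Poly_Mapping.lookup v j *\<^sub>R Poly_Mapping.single j (1::real))
      \<in> span ((\<lambda>j. Poly_Mapping.single j 1) ` J)"
    using v by (intro span_sum span_scale span_base) auto
  ultimately show "v \<in> span ((\<lambda>j. Poly_Mapping.single j 1) ` J)" by simp
next
  have "subspace {v::'a \<Rightarrow>\<^sub>0 real. Poly_Mapping.keys v \<subseteq> J}"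
  proof (rule subspaceI)
    fix v w :: "'a \<Rightarrow>\<^sub>0 real" and r :: real
    assume "v \<in> {v. Poly_Mapping.keys v \<subseteq> J}"
    then show "r *\<^sub>R v \<in> {v. Poly_Mapping.keys v \<subseteq> J}" by (auto simp: in_keys_iff)
    assume "w \<in> {v. Poly_Mapping.keys v \<subseteq> J}"
    with \<open>v \<in> {v. Poly_Mapping.keys v \<subseteq> J}\<close> show "v + w \<in> {v. Poly_Mapping.keys v \<subseteq> J}"
      using keys_add[of v w] by blast
  qed auto
  moreover have "(\<lambda>j. Poly_Mapping.single j (1::real)) ` J \<subseteq> {v. Poly_Mapping.keys v \<subseteq> J}" by auto
  ultimately have "span ((\<lambda>j. Poly_Mapping.single j (1::real)) ` J) \<subseteq> {v. Poly_Mapping.keys v \<subseteq> J}"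
    by (intro span_minimal)
  then show "v \<in> {v. Poly_Mapping.keys v \<subseteq> J}" if "v \<in> span ((\<lambda>j. Poly_Mapping.single j (1::real)) ` J)" for v
    using that by blast
qed

lemma dim_finite_support:
  assumes "finite J"
  shows "dim {v::'a \<Rightarrow>\<^sub>0 real. Poly_Mapping.keys v \<subseteq> J} = card J"
proof -
  let ?e = "\<lambda>j::'a. Poly_Mapping.single j (1::real)"
  have inj: "inj_on ?e J"
    by (rule inj_onI) (metis keys_single singleton_inject zero_neq_one)
  have ind: "independent (?e ` J)"
  proof (rule independent_if_scalars_zero)
    fix f x assume sum: "(\<Sum>x\<in>?e ` J. f x *\<^sub>R x) = 0" and "x \<in> ?e ` J"
    then obtain j where j: "j \<in> J" "x = ?e j" by blast
    have "Poly_Mapping.lookup (\<Sum>x\<in>?e ` J. f x *\<^sub>R x) j = f (?e j)"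
      using assms j(1)
      by (simp add: sum.reindex[OF inj] lookup_sum lookup_single when_def if_distrib[of "(*) _"] cong: if_cong)
    then show "f x = 0" using sum j(2) by simp
  qed (use assms in simp)
  show ?thesis
    unfolding span_singles[OF assms, symmetric] dim_span_eq_card_independent[OF ind] card_image[OF inj] ..

qed


section \<open>Complex and quaternionic coordinates of the cells\<close>

text \<open>The carrier of a cell consists of real sequences; the entries \<open>2 t\<close> and \<open>2 t + 1\<close> are combined
  to a complex coordinate on which the group acts by a character, and two consecutive complex
  coordinates to a quaternion.\<close>

definition ccoord :: "(nat \<Rightarrow>\<^sub>0 real) \<Rightarrow> nat \<Rightarrow> complex" where
  "ccoord v t = Complex (Poly_Mapping.lookup v (2 * t)) (Poly_Mapping.lookup v (2 * t + 1))"

definition of_ccoords :: "nat \<Rightarrow> (nat \<Rightarrow> complex) \<Rightarrow> nat \<Rightarrow>\<^sub>0 real" where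
  "of_ccoords k z = (\<Sum>j<4*k. Poly_Mapping.single j (if even j then Re (z (j div 2)) else Im (z (j div 2))))"

definition cell_space :: "nat \<Rightarrow> (nat \<Rightarrow>\<^sub>0 real) set" where
  "cell_space k = {v. \<forall>t\<ge>2*k. ccoord v t = 0}"

definition qcoord :: "(nat \<Rightarrow>\<^sub>0 real) \<Rightarrow> nat \<Rightarrow> quat" where
  "qcoord v i = Quat (ccoord v (2 * i)) (ccoord v (2 * i + 1))"

lemma ccoord_add: "ccoord (v + w) t = ccoord v t + ccoord w t"
  and ccoord_scaleR: "ccoord (r *\<^sub>R v) t = r *\<^sub>R ccoord v t"
  and ccoord_0 [simp]: "ccoord 0 t = 0"
  by (simp_all add: ccoord_def lookup_add complex_eq_iff)

lemma ccoord_eqI: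
  assumes "\<And>t. ccoord v t = ccoord w t"
  shows "v = w"
proof (rule poly_mapping_eqI)
  fix j
  show "Poly_Mapping.lookup v j = Poly_Mapping.lookup w j"
    using assms[of "j div 2"] by (cases "even j") (auto simp: ccoord_def elim!: evenE oddE)
qed

lemma ccoord_of_ccoords: "ccoord (of_ccoords k z) t = (if t < 2 * k then z t else 0)"
proof -
  have "Poly_Mapping.lookup (of_ccoords k z) j =
      (if j < 4 * k then if even j then Re (z (j div 2)) else Im (z (j div 2)) else 0)" for j
    by (simp add: of_ccoords_def lookup_sum lookup_single when_def)
  then show ?thesis by (auto simp: ccoord_def complex_eq_iff)
qed

lemma of_ccoords_in_cell_space: "of_ccoords k z \<in> cell_space k"
  by (simp add: cell_space_def ccoord_of_ccoords)

lemma of_ccoords_ccoord: "v \<in> cell_space k \<Longrightarrow> of_ccoords k (ccoord v) = v"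
  by (rule ccoord_eqI) (simp add: ccoord_of_ccoords cell_space_def)

lemma continuous_on_ccoord [continuous_intros]: "continuous_on S (\<lambda>v. ccoord v t)"
proof -
  have "continuous_on S (\<lambda>v. complex_of_real (Poly_Mapping.lookup v (2 * t)) + \<i> * complex_of_real (Poly_Mapping.lookup v (2 * t + 1)))"
    by (intro continuous_intros)
  then show ?thesis by (simp add: ccoord_def Complex_eq)
qed

lemma continuous_on_of_ccoords:
  "(\<And>t. t < 2 * k \<Longrightarrow> continuous_on S (\<lambda>v. z v t)) \<Longrightarrow> continuous_on S (\<lambda>v. of_ccoords k (z v))"
  unfolding of_ccoords_def
proof (intro continuous_on_sum continuous_on_single)
  fix j assume z: "\<And>t. t < 2 * k \<Longrightarrow> continuous_on S (\<lambda>v. z v t)" and "j \<in> {..<4*k}"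
  then have "continuous_on S (\<lambda>v. z v (j div 2))" by auto
  then show "continuous_on S (\<lambda>v. if even j then Re (z v (j div 2)) else Im (z v (j div 2)))"
    by (cases "even j") (auto intro: continuous_intros)
qed

lemma fixed_support_ccoord:
  assumes "finite A"
  shows "dim {v. \<forall>t. ccoord v t \<noteq> 0 \<longrightarrow> t \<in> A} = 2 * card A"
    and "{v. \<forall>t. ccoord v t \<noteq> 0 \<longrightarrow> t \<in> A}
      = span ((\<lambda>j. Poly_Mapping.single j 1) ` ((\<lambda>t. 2 * t) ` A \<union> (\<lambda>t. 2 * t + 1) ` A))"
proof -
  let ?J = "(\<lambda>t. 2 * t) ` A \<union> (\<lambda>t. 2 * t + 1) ` A"
  have J: "j \<in> ?J \<longleftrightarrow> j div 2 \<in> A" for j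
    by (cases "even j") (auto simp: image_iff elim!: evenE oddE)
  have "(\<forall>t. ccoord v t \<noteq> 0 \<longrightarrow> t \<in> A) \<longleftrightarrow> Poly_Mapping.keys v \<subseteq> ?J" for v
  proof
    assume v: "\<forall>t. ccoord v t \<noteq> 0 \<longrightarrow> t \<in> A"
    show "Poly_Mapping.keys v \<subseteq> ?J"
    proof
      fix j assume "j \<in> Poly_Mapping.keys v"
      then have "ccoord v (j div 2) \<noteq> 0"
        by (cases "even j") (auto simp: ccoord_def complex_eq_iff in_keys_iff elim!: evenE oddE)
      then show "j \<in> ?J" using v J by blast
    qed
  next
    assume v: "Poly_Mapping.keys v \<subseteq> ?J"
    show "\<forall>t. ccoord v t \<noteq> 0 \<longrightarrow> t \<in> A"
    proof (intro allI impI)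
      fix t assume "ccoord v t \<noteq> 0"
      then have "2 * t \<in> Poly_Mapping.keys v \<or> 2 * t + 1 \<in> Poly_Mapping.keys v"
        by (auto simp: ccoord_def complex_eq_iff in_keys_iff)
      then have "2 * t \<in> ?J \<or> 2 * t + 1 \<in> ?J" using v by blast
      then show "t \<in> A" unfolding J by simp
    qed
  qed
  then have eq: "{v. \<forall>t. ccoord v t \<noteq> 0 \<longrightarrow> t \<in> A} = {v. Poly_Mapping.keys v \<subseteq> ?J}" by blast
  have fin: "finite ?J" using assms by simp
  have "card ?J = card ((\<lambda>t. 2 * t) ` A) + card ((\<lambda>t. 2 * t + 1) ` A)"
    using assms by (intro card_Un_disjoint) (auto, presburger)
  also have "\<dots> = 2 * card A"
    by (simp add: card_image inj_on_def)
  finally show "dim {v. \<forall>t. ccoord v t \<noteq> 0 \<longrightarrow> t \<in> A} = 2 * card A"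
    unfolding eq dim_finite_support[OF fin] .
  show "{v. \<forall>t. ccoord v t \<noteq> 0 \<longrightarrow> t \<in> A} = span ((\<lambda>j. Poly_Mapping.single j 1) ` ?J)"
    unfolding eq span_singles[OF fin] ..
qed

text \<open>The disk is a closed subset of a cube, the continuous image of a product of compact intervals.\<close>

lemma compact_unit_cell_disk: "compact {v \<in> cell_space k. (\<Sum>t<2*k. (cmod (ccoord v t))\<^sup>2) \<le> 1}"
proof -
  let ?L = "\<lambda>x. \<Sum>j<4*k. Poly_Mapping.single j (x j :: real)"
  let ?B = "?L ` (UNIV \<rightarrow>\<^sub>E {-1..1})"
  have "compactin (product_topology (\<lambda>_. euclidean) UNIV) (UNIV \<rightarrow>\<^sub>E {-1..1::real} :: (nat \<Rightarrow> real) set)"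
    by (simp add: compactin_PiE compactin_euclidean_iff)
  then have "compact (UNIV \<rightarrow>\<^sub>E {-1..1::real} :: (nat \<Rightarrow> real) set)"
    by (simp add: euclidean_product_topology)
  moreover have "continuous_on (UNIV \<rightarrow>\<^sub>E {-1..1}) ?L"
    by (intro continuous_intros continuous_on_subset[OF continuous_on_product_coordinates]) auto
  ultimately have B: "compact ?B" by (rule compact_continuous_image[rotated])
  have look: "Poly_Mapping.lookup (?L x) j = (if j < 4 * k then x j else 0)" for x j
    by (simp add: lookup_sum lookup_single when_def)
  have "{v \<in> cell_space k. (\<Sum>t<2*k. (cmod (ccoord v t))\<^sup>2) \<le> 1} = ?B \<inter> {v. (\<Sum>t<2*k. (cmod (ccoord v t))\<^sup>2) \<le> 1}"
  proof (intro subset_antisym subsetI)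
    fix v assume v: "v \<in> {v \<in> cell_space k. (\<Sum>t<2*k. (cmod (ccoord v t))\<^sup>2) \<le> 1}"
    have small: "cmod (ccoord v t) \<le> 1" for t
    proof (cases "t < 2 * k")
      case True
      then have "(cmod (ccoord v t))\<^sup>2 \<le> (\<Sum>t<2*k. (cmod (ccoord v t))\<^sup>2)"
        by (intro member_le_sum) auto
      then have "(cmod (ccoord v t))\<^sup>2 \<le> 1" using v by auto
      then show ?thesis using power2_le_imp_le[of "cmod (ccoord v t)" 1] by simp
    qed (use v in \<open>simp add: cell_space_def\<close>)
    have "\<bar>Poly_Mapping.lookup v j\<bar> \<le> 1" for j
    proof (cases "even j")
      case True
      then have "Poly_Mapping.lookup v j = Re (ccoord v (j div 2))" by (simp add: ccoord_def)
      then show ?thesis using small[of "j div 2"] abs_Re_le_cmod order_trans by metis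
    next
      case False
      then have "Poly_Mapping.lookup v j = Im (ccoord v (j div 2))" by (simp add: ccoord_def)
      then show ?thesis using small[of "j div 2"] abs_Im_le_cmod order_trans by metis
    qed
    then have "Poly_Mapping.lookup v \<in> UNIV \<rightarrow>\<^sub>E {-1..1}" by (auto simp: abs_le_iff minus_le_iff)
    moreover have "v = ?L (Poly_Mapping.lookup v)"
    proof (rule poly_mapping_eqI)
      fix j
      have "Poly_Mapping.lookup v j = 0" if "\<not> j < 4 * k"
      proof -
        have "ccoord v (j div 2) = 0" using v that by (auto simp: cell_space_def)
        then show ?thesis by (cases "even j") (auto simp: ccoord_def complex_eq_iff elim!: evenE oddE)
      qed
      then show "Poly_Mapping.lookup v j = Poly_Mapping.lookup (?L (Poly_Mapping.lookup v)) j" unfolding look by simp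
    qed
    ultimately show "v \<in> ?B \<inter> {v. (\<Sum>t<2*k. (cmod (ccoord v t))\<^sup>2) \<le> 1}" using v by blast
  next
    fix v assume "v \<in> ?B \<inter> {v. (\<Sum>t<2*k. (cmod (ccoord v t))\<^sup>2) \<le> 1}"
    moreover have "?L x \<in> cell_space k" for x
      by (auto simp: cell_space_def ccoord_def look complex_eq_iff)
    ultimately show "v \<in> {v \<in> cell_space k. (\<Sum>t<2*k. (cmod (ccoord v t))\<^sup>2) \<le> 1}" by blast
  qed
  moreover have "closed {v. (\<Sum>t<2*k. (cmod (ccoord v t))\<^sup>2) \<le> 1}"
    by (intro closed_Collect_le continuous_intros)
  ultimately show ?thesis using compact_Int_closed[OF B] by simp
qed

lemma sum_norm_qcoord: "(\<Sum>i<k. (norm (qcoord v i))\<^sup>2) = (\<Sum>t<2*k. (cmod (ccoord v t))\<^sup>2)"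
  by (induction k) (simp_all add: qcoord_def norm_quat_def)


section \<open>The cells of projective space\<close>

definition croot :: "nat \<Rightarrow> int \<Rightarrow> complex" where
  "croot n m = qfst (root_power n m)"

lemma root_power_croot: "root_power n m = Quat (croot n m) 0"
  by (simp add: croot_def root_power_def quat_of_complex_def)

lemma croot_cis: "croot n m = cis (of_int m * (2 * pi / real n))"
  by (simp add: croot_def root_power_def quat_of_complex_def cis_power_int)

lemma croot_add: "croot n (a + b) = croot n a * croot n b"
  by (simp only: croot_cis cis_mult of_int_add distrib_right)

lemma cnj_croot: "cnj (croot n a) = croot n (- a)"
  by (simp add: croot_cis cis_cnj)

lemma cmod_croot [simp]: "cmod (croot n a) = 1"
  by (simp add: croot_cis)

lemma croot_mult_cnj [simp]: "croot n a * cnj (croot n a) = 1"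
  by (simp add: complex_norm_square[symmetric])

text \<open>The exponent of \<open>\<zeta>\<close> by which the generator acts on the complex coordinate \<open>t\<close>. For the entry
  \<open>a + b j\<close> at \<open>i\<close>, the product \<open>\<zeta>\<^bsup>-k\<^esup> (a + b j) \<zeta>\<^bsup>i\<^esup>\<close> has the components \<open>\<zeta>\<^bsup>i-k\<^esup> a\<close> and
  \<open>\<zeta>\<^bsup>-i-k\<^esup> b\<close>, because \<open>j z = cnj z j\<close>. These are the coordinates \<open>t = 2 i\<close> and \<open>t = 2 i + 1\<close>.\<close>

definition weight :: "nat \<Rightarrow> nat \<Rightarrow> int" where
  "weight k t = (if even t then int (t div 2) else - int (t div 2)) - int k"

text \<open>Quaternionic \<open>k\<close>-space as a real representation; only finitely many coordinates are used, so
  that the carriers for all \<open>k\<close> lie in a common space.\<close>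

definition projective_cell ::
  "nat \<Rightarrow> nat \<Rightarrow> ((int \<times> (nat \<Rightarrow>\<^sub>0 real)) set \<Rightarrow> 'x) \<Rightarrow> (int, nat \<Rightarrow>\<^sub>0 real, 'x) cell" where
  "projective_cell n k a =
     \<lparr>rgroup = carrier (integer_mod_group n), rspace = cell_space k,
      ract = (\<lambda>g v. of_ccoords k (\<lambda>t. croot n (weight k t * g) * ccoord v t)),
      rinner = (\<lambda>v w. \<Sum>t<2*k. Re (ccoord v t * cnj (ccoord w t))), cattach = a\<rparr>"

lemma rinner_self: "rinner (projective_cell n k a) v v = (\<Sum>t<2*k. (cmod (ccoord v t))\<^sup>2)"
proof -
  have "Re (z * cnj z) = (cmod z)\<^sup>2" for z
    unfolding cmod_power2 by (simp add: power2_eq_square)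
  then show ?thesis by (simp add: projective_cell_def)
qed

lemma croot_mod:
  assumes "n \<ge> 1"
  shows "croot n (w * (a mod int n)) = croot n (w * a)"
proof -
  have "w * (a mod int n) - w * a = - (w * (a - a mod int n))" by (simp add: algebra_simps)
  then have "int n dvd w * (a mod int n) - w * a"
    by (simp add: dvd_mult flip: mod_eq_dvd_iff)
  then show ?thesis by (simp add: croot_def root_power_cong[OF assms])
qed

lemma full_rep_projective_cell:
  assumes "n \<ge> 1"
  shows "full_rep (integer_mod_group n) (projective_cell n k a)"
proof -
  interpret group "integer_mod_group n" by simp
  let ?R = "projective_cell n k a"
  have "{v. \<forall>t. ccoord v t \<noteq> 0 \<longrightarrow> t \<in> {..<2*k}} = cell_space k"
    by (auto simp: cell_space_def not_le[symmetric])
  then have span: "\<exists>B. finite B \<and> cell_space k = span B"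
    using fixed_support_ccoord(2)[OF finite_lessThan, of "2*k"]
    by (intro exI[of _ "(\<lambda>j. Poly_Mapping.single j 1) ` ((\<lambda>t. 2 * t) ` {..<2*k} \<union> (\<lambda>t. 2 * t + 1) ` {..<2*k})"]) simp
  have "is_real_rep (integer_mod_group n) ?R"
    unfolding is_real_rep_def Let_def
  proof (intro conjI ballI allI impI)
    show "subgroup (rgroup ?R) (integer_mod_group n)"
      by (simp add: projective_cell_def subgroup_self)
    show "\<exists>B. finite B \<and> rspace ?R = span B" using span by (simp add: projective_cell_def)
    fix g h v assume gh: "g \<in> rgroup ?R" "h \<in> rgroup ?R" and v: "v \<in> rspace ?R"
    show "ract ?R (g \<otimes>\<^bsub>integer_mod_group n\<^esub> h) v = ract ?R g (ract ?R h v)"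
      by (rule ccoord_eqI)
        (simp add: projective_cell_def ccoord_of_ccoords croot_mod[OF assms] distrib_left croot_add mult.assoc)
  next
    fix v assume "v \<in> rspace ?R"
    then show "ract ?R \<one>\<^bsub>integer_mod_group n\<^esub> v = v"
      by (simp add: projective_cell_def croot_cis of_ccoords_ccoord)
  next
    fix v assume v: "v \<in> rspace ?R" "v \<noteq> 0"
    then obtain t where t: "ccoord v t \<noteq> 0" using ccoord_eqI[of v 0] by auto
    then have "t < 2 * k" using v(1) by (auto simp: projective_cell_def cell_space_def not_le[symmetric])
    then have "0 < (\<Sum>t<2*k. (cmod (ccoord v t))\<^sup>2)"
      using t by (intro sum_pos2[of _ t]) auto
    then show "0 < rinner ?R v v" by (simp only: rinner_self)
  next
    fix g v w
    have unit: "croot n m * x * cnj (croot n m * y) = x * cnj y" for m x y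
      using croot_mult_cnj[of n m] by (simp add: mult_ac)
    have inner: "rinner ?R x y = (\<Sum>t<2*k. Re (ccoord x t * cnj (ccoord y t)))" for x y
      by (simp add: projective_cell_def)
    have rot: "ccoord (ract ?R g x) t = croot n (weight k t * g) * ccoord x t" if "t < 2 * k" for x t
      using that by (simp add: projective_cell_def ccoord_of_ccoords)
    show "rinner ?R (ract ?R g v) (ract ?R g w) = rinner ?R v w"
      unfolding inner by (intro sum.cong refl) (simp only: rot lessThan_iff unit)
  qed (auto simp: projective_cell_def of_ccoords_in_cell_space ccoord_of_ccoords ccoord_add ccoord_scaleR
      distrib_left distrib_right sum.distrib sum_distrib_left mult_ac algebra_simps intro!: ccoord_eqI sum.cong)
  moreover have "continuous_on (rspace ?R) (ract ?R g)" for g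
    by (auto simp: projective_cell_def intro!: continuous_on_of_ccoords continuous_intros)
  ultimately show ?thesis
    by unfold_locales (auto simp: projective_cell_def)
qed


section \<open>Dimensions of fixed spaces\<close>

text \<open>The action is diagonal in the complex coordinates, so the fixed space is spanned by those whose
  character is trivial on \<open>S\<close>. The factor \<open>2\<close> is the real dimension of a complex line.\<close>

lemma fixed_dim_projective_cell:
  assumes "n \<ge> 1"
  shows "fixed_dim (projective_cell n k a) S = 2 * card {t. t < 2 * k \<and> (\<forall>g\<in>S. int n dvd weight k t * g)}"
proof -
  let ?A = "{t. t < 2 * k \<and> (\<forall>g\<in>S. int n dvd weight k t * g)}"
  have one: "croot n m = 1 \<longleftrightarrow> int n dvd m" for m
    using qfst_root_power_eq_1_iff[OF assms] by (simp add: croot_def)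
  have "v \<in> cell_space k \<and> (\<forall>g\<in>S. of_ccoords k (\<lambda>t. croot n (weight k t * g) * ccoord v t) = v) \<longleftrightarrow>
      (\<forall>t. ccoord v t \<noteq> 0 \<longrightarrow> t \<in> ?A)" (is "?l \<longleftrightarrow> ?r") for v
  proof
    assume l: ?l
    show ?r
    proof (intro allI impI)
      fix t assume t: "ccoord v t \<noteq> 0"
      then have tk: "t < 2 * k" using l by (auto simp: cell_space_def not_le[symmetric])
      have "int n dvd weight k t * g" if "g \<in> S" for g
      proof -
        have "ccoord (of_ccoords k (\<lambda>t. croot n (weight k t * g) * ccoord v t)) t = ccoord v t"
          using l that by simp
        then show ?thesis using t tk by (simp add: ccoord_of_ccoords one)
      qed
      then show "t \<in> ?A" using tk by blast
    qed
  next
    assume r: ?r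
    then have "v \<in> cell_space k" by (auto simp: cell_space_def not_le[symmetric])
    moreover have "of_ccoords k (\<lambda>t. croot n (weight k t * g) * ccoord v t) = v" if "g \<in> S" for g
      using r that by (intro ccoord_eqI) (auto simp: ccoord_of_ccoords one)
    ultimately show ?l by blast
  qed
  then have "{v \<in> rspace (projective_cell n k a). \<forall>g\<in>S. ract (projective_cell n k a) g v = v}
      = {v. \<forall>t. ccoord v t \<noteq> 0 \<longrightarrow> t \<in> ?A}"
    by (simp add: projective_cell_def)
  then show ?thesis
    unfolding fixed_dim_def using fixed_support_ccoord(1)[of ?A] by simp
qed

text \<open>Up to sign, the even coordinates have weights \<open>k, \<dots>, 1\<close> and the odd ones \<open>k, \<dots>, 2 k - 1\<close>.\<close>

lemma card_fixed_weights:
  fixes n k :: nat and S :: "int set"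
  defines "A \<equiv> {s::nat. \<forall>g\<in>S. int n dvd int s * g}"
  shows "card {t. t < 2 * k \<and> (\<forall>g\<in>S. int n dvd weight k t * g)}
    = card (A \<inter> {1..k}) + card (A \<inter> {k..<2*k})"
proof -
  let ?C = "{t. t < 2 * k \<and> (\<forall>g\<in>S. int n dvd weight k t * g)}"
  have "weight k (2 * (k - s)) = - int s" if "s \<le> k" for s
    using that by (simp add: weight_def)
  moreover have "weight k (2 * (s - k) + 1) = - int s" if "k \<le> s" for s
    using that by (simp add: weight_def)
  ultimately have C: "?C = (\<lambda>s. 2 * (k - s)) ` (A \<inter> {1..k}) \<union> (\<lambda>s. 2 * (s - k) + 1) ` (A \<inter> {k..<2*k})"
    (is "_ = ?E \<union> ?O")
  proof (intro subset_antisym subsetI)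
    fix t assume t: "t \<in> ?C"
    show "t \<in> ?E \<union> ?O"
    proof (cases "even t")
      case True
      \<comment> \<open>the absolute value of the weight at \<open>t\<close>\<close>
      define s where "s = k - t div 2"
      have s: "t = 2 * (k - s)" "weight k t = - int s" "s \<in> {1..k}"
        using t True by (auto simp: s_def weight_def elim!: evenE)
      have "s \<in> A" using t unfolding mem_Collect_eq s(2) by (simp add: A_def)
      then show ?thesis using s(1,3) by blast
    next
      case False
      \<comment> \<open>again the absolute value of the weight\<close>
      define s where "s = k + t div 2"
      have s: "t = 2 * (s - k) + 1" "weight k t = - int s" "s \<in> {k..<2*k}"
        using t False by (auto simp: s_def weight_def elim!: oddE)
      have "s \<in> A" using t unfolding mem_Collect_eq s(2) by (simp add: A_def)
      then show ?thesis using s(1,3) by blast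
    qed
  qed (auto simp: A_def)
  have "card ?C = card ?E + card ?O"
    unfolding C by (intro card_Un_disjoint) (auto, presburger)
  moreover have "card ?E = card (A \<inter> {1..k})" "card ?O = card (A \<inter> {k..<2*k})"
    by (auto intro!: card_image inj_onI)
  ultimately show ?thesis by simp
qed

text \<open>In passing from \<open>k\<close> to \<open>k + 1\<close>, the first interval of weights grows, while the second one loses
  \<open>k\<close> and gains \<open>2 k\<close> and \<open>2 k + 1\<close>. A loss is compensated because the weights that are trivial on
  \<open>S\<close> are closed under doubling.\<close>

lemma fixed_dim_projective_cell_mono:
  assumes "n \<ge> 1" "k \<le> l"
  shows "fixed_dim (projective_cell n k a) S \<le> fixed_dim (projective_cell n l b) S"
proof -
  define A where "A = {s::nat. \<forall>g\<in>S. int n dvd int s * g}"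
  define c where "c k = card (A \<inter> {1..k}) + card (A \<inter> {k..<2*k})" for k
  have dim: "fixed_dim (projective_cell n k a) S = 2 * c k" for k and a :: "(int \<times> (nat \<Rightarrow>\<^sub>0 real)) set \<Rightarrow> 'x"
    by (simp add: fixed_dim_projective_cell[OF assms(1)] card_fixed_weights c_def A_def)
  have "c k \<le> c (Suc k)" for k
  proof -
    have "card (A \<inter> {1..k}) \<le> card (A \<inter> {1..Suc k})"
      by (intro card_mono) auto
    moreover have "card (A \<inter> {k..<2*k}) \<le> card (A \<inter> {Suc k..<2 * Suc k})"
    proof (rule card_inj_on_le)
      \<comment> \<open>replace the lost weight \<open>k\<close> by \<open>2 k\<close>\<close>
      show "inj_on (\<lambda>s. if s = k then 2 * k else s) (A \<inter> {k..<2*k})"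
        by (rule inj_onI) (auto split: if_splits)
      have "2 * k \<in> A" if "k \<in> A"
        using that by (auto simp: A_def mult.assoc)
      then show "(\<lambda>s. if s = k then 2 * k else s) ` (A \<inter> {k..<2*k}) \<subseteq> A \<inter> {Suc k..<2 * Suc k}"
        by auto
    qed simp
    ultimately show ?thesis by (simp add: c_def)
  qed
  then have "c k \<le> c l" using assms(2) by (rule lift_Suc_mono_le)
  then show ?thesis using dim[of k a] dim[of l b] by simp
qed

lemma fixed_dim_trivial: "n \<ge> 1 \<Longrightarrow> fixed_dim (projective_cell n k a) {0} = 4 * k"
  by (simp add: fixed_dim_projective_cell flip: lessThan_def)


section \<open>The disk in homogeneous coordinates\<close>

text \<open>The vector of norm \<open>1\<close> over the point \<open>v\<close> of the disk whose last entry is real and nonnegative.\<close>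

definition disk_coords :: "nat \<Rightarrow> (nat \<Rightarrow>\<^sub>0 real) \<Rightarrow> nat \<Rightarrow> quat" where
  "disk_coords k v = (\<lambda>i. if i < k then qcoord v i
     else if i = k then of_real (sqrt (1 - (\<Sum>t<2*k. (cmod (ccoord v t))\<^sup>2))) else 0)"

definition cell_disk :: "nat \<Rightarrow> (nat \<Rightarrow>\<^sub>0 real) set" where
  "cell_disk k = {v \<in> cell_space k. (\<Sum>t<2*k. (cmod (ccoord v t))\<^sup>2) \<le> 1}"

lemma disk_coords_in_coord_space: "disk_coords k v \<in> coord_space (Suc k)"
  by (simp add: coord_space_def disk_coords_def)

lemma norm_disk_coords:
  assumes "v \<in> cell_disk k"
  shows "(\<Sum>i<Suc k. (norm (disk_coords k v i))\<^sup>2) = 1"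
proof -
  have "(\<Sum>i<k. (norm (disk_coords k v i))\<^sup>2) = (\<Sum>t<2*k. (cmod (ccoord v t))\<^sup>2)"
    by (simp add: disk_coords_def flip: sum_norm_qcoord)
  then show ?thesis using assms by (simp add: disk_coords_def cell_disk_def)
qed

lemma disk_coords_nonzero:
  assumes "v \<in> cell_disk k"
  shows "disk_coords k v \<in> nonzero_coords (Suc k)"
proof -
  have "disk_coords k v \<noteq> (\<lambda>_. 0)"
    using norm_disk_coords[OF assms] by auto
  then show ?thesis using disk_coords_in_coord_space by (auto simp: nonzero_coords_def)
qed

lemma continuous_on_disk_coords: "continuous_on S (\<lambda>v. disk_coords k v i)"
  by (cases i k rule: linorder_cases) (auto simp: disk_coords_def qcoord_def intro!: continuous_intros)

text \<open>The entries below \<open>k\<close> are already the quaternionic coordinates of the point.\<close>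

lemma disk_coords_inject:
  assumes "v \<in> cell_space k" "w \<in> cell_space k" "\<And>i. i < k \<Longrightarrow> disk_coords k v i = disk_coords k w i"
  shows "v = w"
proof (rule ccoord_eqI)
  fix t
  show "ccoord v t = ccoord w t"
  proof (cases "t < 2 * k")
    case True
    then have "qcoord v (t div 2) = qcoord w (t div 2)"
      using assms(3)[of "t div 2"] by (simp add: disk_coords_def split: if_splits)
    then show ?thesis
      by (cases "even t") (auto simp: qcoord_def)
  qed (use assms in \<open>simp add: cell_space_def\<close>)
qed

text \<open>The factor \<open>l\<close> is the phase of the last entry, or \<open>1\<close> if that entry vanishes. This choice is not
  continuous in \<open>x\<close>, so it yields surjectivity but no section; compactness has to take its place in
  \<open>openin_proj_flag_Suc\<close> below.\<close>

lemma unit_vector_eq_disk_coords: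
  assumes x: "x \<in> coord_space (Suc k)" and norm: "(\<Sum>i<Suc k. (norm (x i))\<^sup>2) = 1"
  shows "\<exists>l v. norm l = 1 \<and> v \<in> cell_disk k \<and> x = (\<lambda>i. l * disk_coords k v i)"
proof -
  define l where "l = (if x k = 0 then 1 else sgn (x k))"
  have l: "norm l = 1" "l * of_real (norm (x k)) = x k" "l \<noteq> 0"
    by (auto simp: l_def norm_sgn sgn_div_norm sgn_zero_iff scaleR_conv_of_real[symmetric] of_real_def)
  \<comment> \<open>the last entry of \<open>y\<close> is the norm of the last entry of \<open>x\<close>\<close>
  define y where "y i = inverse l * x i" for i
  have ly: "l * y i = x i" for i
    using l(3) by (simp add: y_def flip: mult.assoc)
  have ny: "norm (y i) = norm (x i)" for i
    using l(1) by (simp add: y_def norm_mult norm_inverse)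
  define v where "v = of_ccoords k (\<lambda>t. if even t then qfst (y (t div 2)) else qsnd (y (t div 2)))"
  have qv: "qcoord v i = y i" if "i < k" for i
    using that by (simp add: qcoord_def v_def ccoord_of_ccoords)
  then have N: "(\<Sum>t<2*k. (cmod (ccoord v t))\<^sup>2) = 1 - (norm (x k))\<^sup>2"
    using norm by (simp add: ny flip: sum_norm_qcoord)
  have "v \<in> cell_disk k"
    by (simp add: cell_disk_def N) (simp add: v_def of_ccoords_in_cell_space)
  moreover have "x i = l * disk_coords k v i" for i
    using qv ly l(2) x by (auto simp: disk_coords_def N coord_space_def)
  ultimately show ?thesis using l(1) by blast
qed


section \<open>Attaching the cells of projective space\<close>

context coordinates_action
begin

definition attaching_map :: "nat \<Rightarrow> (int \<times> (nat \<Rightarrow>\<^sub>0 real)) set \<Rightarrow> 'q set" where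
  "attaching_map k = (line \<circ> disk_coords k) \<circ> full_rep.base_vector (integer_mod_group n)"

abbreviation flag_cell :: "nat \<Rightarrow> (int, nat \<Rightarrow>\<^sub>0 real, 'q set) cell" where
  "flag_cell k \<equiv> projective_cell n k (attaching_map k)"

lemma flag_cell_disk: "{v \<in> rspace (flag_cell k). rinner (flag_cell k) v v \<le> 1} = cell_disk k"
  unfolding rinner_self cell_disk_def by (simp add: projective_cell_def)

text \<open>Multiplying the entry at \<open>k\<close> by \<open>\<zeta>\<close> to the power \<open>k g\<close> destroys its reality; the scalar
  \<open>\<zeta>\<close> to the power \<open>- k g\<close> restores it without changing the line, and acts on the other entries as the
  representation of the cell does.\<close>

lemma line_disk_coords_ract:
  assumes g: "g \<in> carrier (integer_mod_group n)" and v: "v \<in> cell_disk k"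
  shows "line (disk_coords k (ract (flag_cell k) g v)) = act g ` line (disk_coords k v)"
proof -
  interpret full_rep "integer_mod_group n" "flag_cell k"
    by (rule full_rep_projective_cell[OF n_pos])
  let ?w = "ract (flag_cell k) g v"
  have "v \<in> rspace (flag_cell k)" using v by (simp add: cell_disk_def projective_cell_def)
  then have N: "(\<Sum>t<2*k. (cmod (ccoord ?w t))\<^sup>2) = (\<Sum>t<2*k. (cmod (ccoord v t))\<^sup>2)"
    unfolding rinner_self[of n k "attaching_map k", symmetric] by (intro rinner_ract[OF g])
  have "disk_coords k ?w i = root_power n (- (int k * g)) * coord_act g (disk_coords k v) i" for i
  proof (cases i k rule: linorder_cases)
    case less
    have "croot n (weight k (2 * i) * g) = croot n (- (int k * g)) * croot n (int i * g)"
      "croot n (weight k (2 * i + 1) * g) = croot n (- (int k * g)) * croot n (- (int i * g))"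
      by (simp_all add: weight_def algebra_simps flip: croot_add)
    then have "qcoord ?w i = root_power n (- (int k * g)) * (qcoord v i * root_power n (int i * g))"
      using less
      by (simp add: qcoord_def projective_cell_def ccoord_of_ccoords root_power_croot
          times_quat_def cnj_croot)
    then show ?thesis using less by (simp add: disk_coords_def coord_act_def)
  next
    case equal
    have "root_power n (- (int k * g)) * root_power n (int k * g) = 1"
      by (simp flip: root_power_add)
    then have "root_power n (- (int k * g)) * (of_real r * root_power n (int k * g)) = of_real r" for r
      by (simp add: of_real_def)
    then show ?thesis using equal by (simp add: disk_coords_def coord_act_def N)
  qed (simp add: disk_coords_def coord_act_def)
  then have eq: "disk_coords k ?w = (\<lambda>i. root_power n (- (int k * g)) * coord_act g (disk_coords k v) i)"
    by blast
  have "coord_act g (disk_coords k v) \<in> fin_coords" "disk_coords k ?w \<in> fin_coords"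
    using coord_act_coord_space disk_coords_in_coord_space coord_space_subset_fin by blast+
  then have "line (coord_act g (disk_coords k v)) = line (disk_coords k ?w)"
    using line_eq_iff eq root_power_nonzero by blast
  then show ?thesis
    using act_line_nonzero[OF g disk_coords_nonzero[OF v]] by simp
qed

lemma line_disk_coords_boundary:
  assumes "v \<in> cell_disk k"
  shows "line (disk_coords k v) \<in> line ` nonzero_coords k \<longleftrightarrow> (\<Sum>t<2*k. (cmod (ccoord v t))\<^sup>2) = 1"
proof -
  have "disk_coords k v \<in> nonzero_coords k \<longleftrightarrow> disk_coords k v k = 0"
    using disk_coords_nonzero[OF assms] by (auto simp: nonzero_coords_def coord_space_def le_Suc_eq)
      (metis le_antisym not_less_eq_eq)
  then show ?thesis
    using line_in_image_iff[OF disk_coords_nonzero[OF assms]] by (simp add: disk_coords_def)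
qed

text \<open>The last entries are real, the first one positive, so the factor \<open>l\<close> between the two spanning
  vectors is real and nonnegative. Both vectors have norm \<open>1\<close>, which leaves \<open>l = 1\<close>.\<close>

lemma line_disk_coords_interior:
  assumes v: "v \<in> cell_disk k" "(\<Sum>t<2*k. (cmod (ccoord v t))\<^sup>2) \<noteq> 1" and w: "w \<in> cell_disk k"
    and eq: "line (disk_coords k v) = line (disk_coords k w)"
  shows "v = w"
proof -
  obtain l where l: "disk_coords k w = (\<lambda>i. l * disk_coords k v i)"
    using eq line_eq_iff disk_coords_in_coord_space coord_space_subset_fin by blast
  let ?r = "\<lambda>v. sqrt (1 - (\<Sum>t<2*k. (cmod (ccoord v t))\<^sup>2))"
  have r: "?r v > 0" "?r w \<ge> 0" using v w by (auto simp: cell_disk_def)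
  have "of_real (?r w) = l * of_real (?r v)"
    using fun_cong[OF l, of k] by (simp add: disk_coords_def)
  then have "?r w *\<^sub>R (1::quat) = ?r v *\<^sub>R l"
    by (simp add: of_real_def)
  then have "inverse (?r v) *\<^sub>R (?r v *\<^sub>R l) = inverse (?r v) *\<^sub>R (?r w *\<^sub>R (1::quat))"
    by (simp only:)
  then have lr: "l = (?r w / ?r v) *\<^sub>R 1"
    using r(1) by (simp only: scaleR_scaleR divide_inverse_commute) simp
  have "1 = (\<Sum>i<Suc k. (norm (l * disk_coords k v i))\<^sup>2)"
    using norm_disk_coords[OF w] l by simp
  also have "\<dots> = (norm l)\<^sup>2 * (\<Sum>i<Suc k. (norm (disk_coords k v i))\<^sup>2)"
    by (simp only: norm_mult power_mult_distrib sum_distrib_left)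
  finally have "norm l = 1"
    using norm_disk_coords[OF v(1)] by (simp add: power2_eq_1_iff) (metis norm_ge_zero not_one_le_zero neg_0_le_iff_le)
  then have "l = 1" using lr r by simp
  then have "disk_coords k w = disk_coords k v" using l by simp
  then show ?thesis using v(1) w by (intro disk_coords_inject) (auto simp: cell_disk_def)
qed

lemma continuous_map_line_disk_coords:
  "continuous_map (top_of_set (cell_disk k)) (proj_space smul (flag (Suc k))) (line \<circ> disk_coords k)"
proof (rule continuous_map_compose)
  show "continuous_map (top_of_set (cell_disk k)) (top_of_set (nonzero_coords (Suc k))) (disk_coords k)"
    using disk_coords_nonzero continuous_on_coordinatewise_then_product[OF continuous_on_disk_coords]
    by (auto simp: continuous_map_in_subtopology)
  show "continuous_map (top_of_set (nonzero_coords (Suc k))) (proj_space smul (flag (Suc k))) line"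
    by (rule quotient_imp_continuous_map[OF quotient_map_line])
qed

text \<open>Every line is spanned by a vector of norm \<open>1\<close>, which can be chosen continuously in a given
  spanning vector.\<close>

lemma normalized_coords:
  fixes k :: nat
  defines "nm \<equiv> \<lambda>x::nat \<Rightarrow> quat. sqrt (\<Sum>i<k. (norm (x i))\<^sup>2)"
  assumes x: "x \<in> nonzero_coords k"
  shows "nm x > 0" "(\<lambda>i. inverse (nm x) *\<^sub>R x i) \<in> nonzero_coords k"
    "(\<Sum>i<k. (norm (inverse (nm x) *\<^sub>R x i))\<^sup>2) = 1"
    "line (\<lambda>i. inverse (nm x) *\<^sub>R x i) = line x"
proof -
  obtain i where "x i \<noteq> 0" "i < k"
    using x by (fastforce simp: nonzero_coords_def coord_space_def not_le[symmetric])
  then have "0 < (\<Sum>i<k. (norm (x i))\<^sup>2)"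
    by (intro sum_pos2[of _ i]) auto
  then show pos: "nm x > 0" by (simp add: nm_def)
  show nz: "(\<lambda>i. inverse (nm x) *\<^sub>R x i) \<in> nonzero_coords k"
    using x pos by (auto simp: nonzero_coords_def coord_space_def fun_eq_iff)
  have "(\<Sum>i<k. (norm (inverse (nm x) *\<^sub>R x i))\<^sup>2) = (inverse (nm x))\<^sup>2 * (\<Sum>i<k. (norm (x i))\<^sup>2)"
    by (simp add: power_mult_distrib sum_distrib_left abs_of_pos[OF pos])
  also have "(\<Sum>i<k. (norm (x i))\<^sup>2) = (nm x)\<^sup>2"
    by (simp add: nm_def sum_nonneg)
  finally show "(\<Sum>i<k. (norm (inverse (nm x) *\<^sub>R x i))\<^sup>2) = 1"
    using pos by (simp flip: power_mult_distrib)
  have "(\<lambda>i. inverse (nm x) *\<^sub>R x i) = (\<lambda>i. of_real (inverse (nm x)) * x i)"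
    by (simp add: scaleR_conv_of_real)
  moreover have "of_real (inverse (nm x)) \<noteq> (0::quat)" using pos by simp
  ultimately show "line (\<lambda>i. inverse (nm x) *\<^sub>R x i) = line x"
    using line_eq_iff nz x nonzero_subset_fin by blast
qed

lemma line_disk_coords_surj: "line ` nonzero_coords (Suc k) \<subseteq> (line \<circ> disk_coords k) ` cell_disk k"
proof
  fix p assume "p \<in> line ` nonzero_coords (Suc k)"
  then obtain x where x: "x \<in> nonzero_coords (Suc k)" "p = line x" by blast
  note y = normalized_coords(2-4)[OF x(1)]
  obtain l v where lv: "norm l = 1" "v \<in> cell_disk k"
    "(\<lambda>i. inverse (sqrt (\<Sum>i<Suc k. (norm (x i))\<^sup>2)) *\<^sub>R x i) = (\<lambda>i. l * disk_coords k v i)"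
    using unit_vector_eq_disk_coords[OF _ y(2)] y(1) by (auto simp: nonzero_coords_def)
  have "l \<noteq> 0" using lv(1) by auto
  then have "line (disk_coords k v) = p"
    using line_eq_iff[of "disk_coords k v"] lv(3) y x nonzero_subset_fin disk_coords_nonzero[OF lv(2)] by blast
  then show "p \<in> (line \<circ> disk_coords k) ` cell_disk k" using lv(2) by auto
qed

text \<open>The stage carries the quotient topology of the disk. Let \<open>A\<close> be the part of the disk over the
  complement of \<open>U\<close>; it is compact. The unit vectors spanning a line outside \<open>U\<close> form the set \<open>B\<close> of all
  multiples of vectors over \<open>A\<close> by unit quaternions, a continuous image of a compact set and
  hence closed. Normalisation pulls \<open>B\<close> back to the set of all spanning vectors of lines outside \<open>U\<close>.\<close>

lemma openin_proj_flag_Suc: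
  assumes U: "U \<subseteq> line ` nonzero_coords (Suc k)"
    and open_U: "openin (top_of_set (cell_disk k)) {v \<in> cell_disk k. line (disk_coords k v) \<in> U}"
  shows "openin (proj_space smul (flag (Suc k))) U"
proof -
  let ?N = "nonzero_coords (Suc k)"
  define A where "A = cell_disk k - {v \<in> cell_disk k. line (disk_coords k v) \<in> U}"
  have "closedin (top_of_set (cell_disk k)) A"
    using open_U by (auto simp: A_def)
  then have "compact A"
    using closedin_compact compact_unit_cell_disk[of k] by (auto simp: cell_disk_def)
  define scale where "scale = (\<lambda>(v, l) i. l * disk_coords k v i)"
  define B where "B = scale ` (A \<times> {l. norm l = 1})"
  have "continuous_on (A \<times> {l. norm l = 1}) scale"
    unfolding scale_def case_prod_beta
  proof (intro continuous_on_coordinatewise_then_product continuous_on_mult)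
    show "continuous_on (A \<times> {l. norm l = 1}) (\<lambda>p. disk_coords k (fst p) i)" for i
      by (rule continuous_on_compose2[OF continuous_on_disk_coords[of UNIV]]) (auto intro: continuous_intros)
  qed (intro continuous_intros)
  then have "compact B"
    unfolding B_def using \<open>compact A\<close> compact_unit_quats
    by (intro compact_continuous_image compact_Times)
  then have "closed B" by (rule compact_imp_closed)
  \<comment> \<open>normalisation to the unit sphere\<close>
  define h where "h x = (\<lambda>i. inverse (sqrt (\<Sum>i<Suc k. (norm (x i))\<^sup>2)) *\<^sub>R x i)" for x :: "nat \<Rightarrow> quat"
  have "continuous_on ?N h"
    unfolding h_def
  proof (intro continuous_on_coordinatewise_then_product continuous_on_scaleR continuous_on_inverse)
    have coord: "continuous_on ?N (\<lambda>x. x i)" for i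
      by (rule continuous_on_subset[OF continuous_on_product_coordinates]) simp
    show "continuous_on ?N (\<lambda>x. x i)" for i by (rule coord)
    show "continuous_on ?N (\<lambda>x. sqrt (\<Sum>i<Suc k. (norm (x i))\<^sup>2))"
      by (intro continuous_intros coord)
    show "\<forall>x\<in>?N. sqrt (\<Sum>i<Suc k. (norm (x i))\<^sup>2) \<noteq> 0"
      using normalized_coords(1) by fastforce
  qed
  then have closed: "closedin (top_of_set ?N) (?N \<inter> h -` B)"
    using \<open>closed B\<close> by (rule continuous_closedin_preimage)
  have hB: "h x \<in> B \<longleftrightarrow> line x \<notin> U" if x: "x \<in> ?N" for x
  proof -
    have line: "line (h x) = line x" and nz: "h x \<in> ?N"
      and one: "(\<Sum>i<Suc k. (norm (h x i))\<^sup>2) = 1"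
      unfolding h_def using normalized_coords(2-4)[OF x] by simp_all
    have same: "line (disk_coords k v) = line x"
      if "norm l = 1" "v \<in> cell_disk k" "h x = (\<lambda>i. l * disk_coords k v i)" for l v
    proof -
      have "l \<noteq> 0" using that(1) by auto
      then show ?thesis
        using line_eq_iff[of "disk_coords k v" "h x"] that line nz nonzero_subset_fin disk_coords_nonzero by blast
    qed
    show ?thesis
    proof
      assume "h x \<in> B"
      then obtain v l where "v \<in> A" "norm l = 1" "h x = (\<lambda>i. l * disk_coords k v i)"
        by (auto simp: B_def scale_def)
      then show "line x \<notin> U" using same[of l v] by (auto simp: A_def)
    next
      assume "line x \<notin> U"
      obtain l v where lv: "norm l = 1" "v \<in> cell_disk k" "h x = (\<lambda>i. l * disk_coords k v i)"
        using unit_vector_eq_disk_coords[OF _ one] nz by (auto simp: nonzero_coords_def)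
      then have "v \<in> A" using same[OF lv] \<open>line x \<notin> U\<close> by (simp add: A_def)
      then show "h x \<in> B" using lv(1,3) by (auto simp: B_def scale_def intro!: image_eqI[of _ _ "(v, l)"])
    qed
  qed
  have "{x \<in> ?N. line x \<in> U} = ?N - (?N \<inter> h -` B)"
    using hB by blast
  then have "openin (top_of_set ?N) {x \<in> ?N. line x \<in> U}"
    using closed by (metis openin_diff openin_subtopology_self)
  then show ?thesis using U by (simp add: openin_proj_flag)
qed

lemma attach_flag_cell:
  "attach_cells (integer_mod_group n) (\<lambda>g. image (act g)) (proj_space smul (flag k))
     (proj_space smul (flag (Suc k))) {0::nat} (\<lambda>_. flag_cell k)"
proof (rule attach_single_cell[where \<psi> = "line \<circ> disk_coords k"])
  show "full_rep (integer_mod_group n) (flag_cell k)"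
    by (rule full_rep_projective_cell[OF n_pos])
  have sub: "line ` nonzero_coords k \<subseteq> line ` nonzero_coords (Suc k)"
    using nonzero_coords_mono[of k "Suc k"] by auto
  then show "topspace (proj_space smul (flag k)) \<subseteq> topspace (proj_space smul (flag (Suc k)))"
    by simp
  show "proj_space smul (flag k)
      = subtopology (proj_space smul (flag (Suc k))) (topspace (proj_space smul (flag k)))"
    unfolding topspace_proj_flag
    unfolding proj_flag_subspace[of k] proj_flag_subspace[of "Suc k"] subtopology_subtopology Int_absorb1[OF sub] ..
  have sphere: "v \<in> cell_disk k \<Longrightarrow> v \<in> {v \<in> rspace (flag_cell k). rinner (flag_cell k) v v = 1} \<longleftrightarrow>
      (\<Sum>t<2*k. (cmod (ccoord v t))\<^sup>2) = 1" for v
    unfolding rinner_self by (simp add: cell_disk_def projective_cell_def)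
  show "(line \<circ> disk_coords k) v \<in> topspace (proj_space smul (flag k)) \<longleftrightarrow>
      v \<in> {v \<in> rspace (flag_cell k). rinner (flag_cell k) v v = 1}"
    if "v \<in> {v \<in> rspace (flag_cell k). rinner (flag_cell k) v v \<le> 1}" for v
    using that line_disk_coords_boundary unfolding flag_cell_disk by (simp only: sphere o_apply topspace_proj_flag)
  show "v = w"
    if "v \<in> {v \<in> rspace (flag_cell k). rinner (flag_cell k) v v \<le> 1} - {v \<in> rspace (flag_cell k). rinner (flag_cell k) v v = 1}"
      "w \<in> {v \<in> rspace (flag_cell k). rinner (flag_cell k) v v \<le> 1} - {v \<in> rspace (flag_cell k). rinner (flag_cell k) v v = 1}"
      "(line \<circ> disk_coords k) v = (line \<circ> disk_coords k) w" for v w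
    using that sphere line_disk_coords_interior[of v k w] unfolding flag_cell_disk by auto
  show "cattach (flag_cell k) = (line \<circ> disk_coords k) \<circ> full_rep.base_vector (integer_mod_group n)"
    by (simp add: projective_cell_def attaching_map_def)
  show "(line \<circ> disk_coords k) (ract (flag_cell k) g v) = act g ` (line \<circ> disk_coords k) v"
    if "g \<in> carrier (integer_mod_group n)" "v \<in> {v \<in> rspace (flag_cell k). rinner (flag_cell k) v v \<le> 1}" for g v
    using that line_disk_coords_ract unfolding flag_cell_disk by simp
qed (use line_disk_coords_surj[of k] continuous_map_line_disk_coords openin_proj_flag_Suc
    in \<open>auto simp: flag_cell_disk\<close>)

lemma topspace_proj_flag_1: "\<exists>p. topspace (proj_space smul (flag 1)) = {p}"
proof -
  let ?e = "\<lambda>i. if i = 0 then 1 else (0::quat)"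
  have e: "?e \<in> nonzero_coords 1" by (auto simp: nonzero_coords_def coord_space_def fun_eq_iff)
  have "line x = line ?e" if "x \<in> nonzero_coords 1" for x
  proof -
    have "x = (\<lambda>i. x 0 * ?e i)" "x 0 \<noteq> 0"
      using that by (auto simp: nonzero_coords_def coord_space_def fun_eq_iff) (metis One_nat_def Suc_leI neq0_conv)
    then show ?thesis
      using line_eq_iff[of ?e x] that e nonzero_subset_fin by blast
  qed
  then have "line ` nonzero_coords 1 = {line ?e}" using e by blast
  then show ?thesis by simp
qed

text \<open>The stage \<open>m\<close> of the filtration has \<open>m + 1\<close> homogeneous coordinates, so the cell attached to it is
  the one of index \<open>m + 1\<close>.\<close>

theorem properly_even_flag_filtration:
  "properly_even_structure (integer_mod_group n) (proj_space smul Q) (\<lambda>g. image (act g))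
     (\<lambda>m. proj_space smul (flag (Suc m)))"
  unfolding properly_even_structure_def
proof (intro exI conjI)
  let ?G = "integer_mod_group n"
  let ?F = "\<lambda>m. proj_space smul (flag (Suc m))"
  obtain p where p: "topspace (?F 0) = {p}" using topspace_proj_flag_1 by auto
  then have discrete: "?F 0 = discrete_topology (topspace (?F 0))"
    by (metis discrete_topology_unique openin_topspace singletonD)
  have union: "topspace (proj_space smul Q) = (\<Union>m. topspace (?F m))"
  proof -
    have "nonzero_coords k \<subseteq> nonzero_coords (Suc k)" for k
      by (rule nonzero_coords_mono) simp
    then show ?thesis unfolding topspace_proj_Q topspace_proj_flag by blast
  qed
  show "cell_complex ?G (proj_space smul Q) (\<lambda>g. image (act g)) ?F (\<lambda>_. {0::nat}) (\<lambda>m _. flag_cell (Suc m))"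
    unfolding cell_complex_def
  proof (intro conjI allI ballI impI)
    fix m
    show "topspace (?F m) \<subseteq> topspace (proj_space smul Q)" unfolding union by blast
    show "?F m = subtopology (proj_space smul Q) (topspace (?F m))"
      unfolding topspace_proj_flag by (rule proj_flag_subspace)
    show "topspace (?F m) \<subseteq> topspace (?F (Suc m))"
      using nonzero_coords_mono[of "Suc m" "Suc (Suc m)"] by auto
    show "image (act g) ` topspace (?F m) \<subseteq> topspace (?F m)" if "g \<in> carrier ?G" for g
      using act_invariant_flag[OF that, of "Suc m"] by simp
    show "attach_cells ?G (\<lambda>g. image (act g)) (?F m) (?F (Suc m)) {0::nat} (\<lambda>_. flag_cell (Suc m))"
      by (rule attach_flag_cell)
    show "openin (proj_space smul Q) U \<longleftrightarrow> (\<forall>m. openin (?F m) (U \<inter> topspace (?F m)))"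
      if "U \<subseteq> topspace (proj_space smul Q)" for U
      using openin_proj_Q_iff_flags[OF that] by (simp only: topspace_proj_flag)
  qed (fact gspace_proj_Q discrete union)+
  show "properly_even ?G ?F (\<lambda>_. {0::nat}) (\<lambda>m _. flag_cell (Suc m))"
    unfolding properly_even_def
  proof (intro conjI allI impI ballI)
    show "finite (topspace (?F 0))" using p by simp
    show "even (fixed_dim (flag_cell (Suc m)) K)" for m K
      by (simp add: fixed_dim_projective_cell[OF n_pos])
    show "rep_ll ?G (flag_cell (Suc m)) (flag_cell (Suc l))" if "m < l" for m l
      unfolding rep_ll_def using that by (intro allI impI fixed_dim_projective_cell_mono[OF n_pos]) simp
    fix N :: nat
    have "subgroup {0} ?G"
      using group.triv_subgroup[OF group_integer_mod_group[of n]] by simp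
    \<comment> \<open>a bound on all fixed spaces bounds the dimension of the cell itself\<close>
    then have "fixed_dim (flag_cell (Suc m)) {0} \<le> N"
      if "\<forall>K. subgroup K ?G \<and> K \<subseteq> rgroup (flag_cell (Suc m)) \<longrightarrow> fixed_dim (flag_cell (Suc m)) K \<le> N" for m
      using that[rule_format, of "{0}"] by (simp add: projective_cell_def)
    then have "m \<in> {..N}"
      if "\<forall>K. subgroup K ?G \<and> K \<subseteq> rgroup (flag_cell (Suc m)) \<longrightarrow> fixed_dim (flag_cell (Suc m)) K \<le> N" for m
      using that unfolding fixed_dim_trivial[OF n_pos] by fastforce
    then have "{(m, i). i \<in> {0::nat} \<and> (\<forall>K. subgroup K ?G \<and> K \<subseteq> rgroup (flag_cell (Suc m)) \<longrightarrow>
        fixed_dim (flag_cell (Suc m)) K \<le> N)} \<subseteq> {..N} \<times> {0}"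
      by blast
    then show "finite {(m, i). i \<in> {0::nat} \<and> (\<forall>K. subgroup K ?G \<and> K \<subseteq> rgroup (flag_cell (Suc m)) \<longrightarrow>
        fixed_dim (flag_cell (Suc m)) K \<le> N)}"
      by (rule finite_subset) simp
  qed simp
qed

end


section \<open>Coordinates adapted to the flag\<close>

text \<open>Scalar multiplication and the action are additive on \<open>Q\<close> only, so sums have to be
  kept inside \<open>V\<close> along the way.\<close>

lemma sum_in_additive:
  fixes V :: "'a::ab_group_add set" and h :: "'a \<Rightarrow> 'b::ab_group_add"
  assumes "finite A" "\<And>i. i \<in> A \<Longrightarrow> b i \<in> V" "0 \<in> V" "\<And>x y. x \<in> V \<Longrightarrow> y \<in> V \<Longrightarrow> x + y \<in> V"
    and h: "\<And>x y. x \<in> V \<Longrightarrow> y \<in> V \<Longrightarrow> h (x + y) = h x + h y"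
  shows "sum b A \<in> V" "h (sum b A) = (\<Sum>i\<in>A. h (b i))"
proof -
  have "h 0 = 0" using h[OF assms(3,3)] by simp
  have "sum b A \<in> V \<and> h (sum b A) = (\<Sum>i\<in>A. h (b i))"
    using assms(1,2) by (induction A) (use assms(3-5) \<open>h 0 = 0\<close> in auto)
  then show "sum b A \<in> V" "h (sum b A) = (\<Sum>i\<in>A. h (b i))" by auto
qed

text \<open>The generator is the preimage of \<open>1\<close>. In \<open>\<Psi>\<^sub>r\<close> the element \<open>g\<close> sends \<open>1\<close> to a power of \<open>\<zeta>\<close>,
  and this power can be read as a scalar acting from the left.\<close>

lemma iso_Psi_generator:
  assumes "iso_Psi n smul act r U" "left_module smul U"
    and act_U: "\<And>g x. g \<in> carrier (integer_mod_group n) \<Longrightarrow> x \<in> U \<Longrightarrow> act g x \<in> U"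
  obtains e where "e \<in> U" "bij_betw (\<lambda>q. smul q e) UNIV U"
    "\<And>g. g \<in> carrier (integer_mod_group n) \<Longrightarrow> act g e = smul (root_power n (r * g)) e"
proof -
  obtain f where f: "bij_betw f U UNIV" "\<And>a x. x \<in> U \<Longrightarrow> f (smul a x) = a * f x"
    "\<And>g x. g \<in> carrier (integer_mod_group n) \<Longrightarrow> x \<in> U \<Longrightarrow> f (act g x) = f x * root_power n (r * g)"
    using assms(1) by (auto simp: iso_Psi_def rep_iso_def Psi_act_eq)
  obtain e where e: "e \<in> U" "f e = 1"
    using f(1) by (metis UNIV_I bij_betw_def imageE)
  have smul_e: "smul q e \<in> U" "f (smul q e) = q" for q
    using f(2) e assms(2) by (auto simp: left_module_def)
  have inj: "x = y" if "f x = f y" "x \<in> U" "y \<in> U" for x y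
    using that f(1) by (auto simp: bij_betw_def inj_on_def)
  have "bij_betw (\<lambda>q. smul q e) UNIV U"
    by (rule bij_betwI[of _ _ _ f]) (use smul_e inj in auto)
  moreover have "act g e = smul (root_power n (r * g)) e" if "g \<in> carrier (integer_mod_group n)" for g
    using inj[OF _ act_U[OF that e(1)] smul_e(1)] f(3)[OF that e(1)] smul_e(2) e(2) by simp
  ultimately show thesis using that e(1) by blast
qed

text \<open>The uniqueness of the decomposition in the direct sum is what makes \<open>vec\<close> injective; the
  generators of the summands make it linear and diagonalise the action.\<close>

lemma flag_coordinates:
  assumes "n \<ge> 1" and flag: "split_full_flag (integer_mod_group n) smul act Q W"
    and iso: "\<And>k. iso_Psi n smul act (int k) (W k)"
  obtains vec where "coordinates_action smul Q vec n act"
    and "\<And>k. vec ` coord_space k = flag_sum W k"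
proof -
  have rep: "quat_rep (integer_mod_group n) smul act Q" and sum: "direct_sum W Q"
    and W_rep: "\<And>k. quat_rep (integer_mod_group n) smul act (W k)"
    using flag by (auto simp: split_full_flag_def irreducible_rep_def)
  have "\<exists>e. e \<in> W k \<and> bij_betw (\<lambda>q. smul q e) UNIV (W k) \<and>
      (\<forall>g\<in>carrier (integer_mod_group n). act g e = smul (root_power n (int k * g)) e)" for k
    using iso_Psi_generator[OF iso[of k]] W_rep[of k] unfolding quat_rep_def by metis
  then obtain e where e: "\<And>k. e k \<in> W k" "\<And>k. bij_betw (\<lambda>q. smul q (e k)) UNIV (W k)"
    "\<And>k g. g \<in> carrier (integer_mod_group n) \<Longrightarrow> act g (e k) = smul (root_power n (int k * g)) (e k)"
    by metis
  have WQ: "W k \<subseteq> Q" for k using sum by (auto simp: direct_sum_def)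
  have eQ: "e k \<in> Q" for k using e(1) WQ by blast
  have Q: "0 \<in> Q" "\<And>x y. x \<in> Q \<Longrightarrow> y \<in> Q \<Longrightarrow> x + y \<in> Q" "\<And>a x. x \<in> Q \<Longrightarrow> smul a x \<in> Q"
    "\<And>a x y. x \<in> Q \<Longrightarrow> y \<in> Q \<Longrightarrow> smul a (x + y) = smul a x + smul a y"
    "\<And>a b x. x \<in> Q \<Longrightarrow> smul (a + b) x = smul a x + smul b x"
    "\<And>a b x. x \<in> Q \<Longrightarrow> smul (a * b) x = smul a (smul b x)"
    using rep by (simp_all add: quat_rep_def left_module_def)
  have act: "act g (x + y) = act g x + act g y" "act g (smul a x) = smul a (act g x)"
    if "g \<in> carrier (integer_mod_group n)" "x \<in> Q" "y \<in> Q" for g x y a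
    using rep that by (simp_all add: quat_rep_def)
  have smul_0: "smul 0 x = 0" if "x \<in> Q" for x
    using Q(5)[OF that, of 0 0] by simp
  have smul_e: "smul q (e k) \<in> W k" "smul q (e k) = smul q' (e k) \<longleftrightarrow> q = q'" for q q' k
    using e(2)[of k] by (auto simp: bij_betw_def inj_on_def)
  have smul_e_0: "smul q (e k) = 0 \<longleftrightarrow> q = 0" for q k
    using smul_e(2)[of q k 0] smul_0[OF eQ] by simp
  define vec where "vec x = (\<Sum>k | x k \<noteq> 0. smul (x k) (e k))" for x
  have vec: "vec x = (\<Sum>k\<in>A. smul (x k) (e k))" if "finite A" "{k. x k \<noteq> 0} \<subseteq> A" for x A
    unfolding vec_def using that smul_e_0 by (intro sum.mono_neutral_left) auto
  note additive = sum_in_additive[where V = Q, OF _ Q(3)[OF eQ] Q(1,2)]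
  have vec_Q: "vec x \<in> Q" if "x \<in> fin_coords" for x
    unfolding vec_def using additive(1)[where h = id] that by (simp add: fin_coords_iff)
  have unique: "\<exists>!f. (\<forall>k. f k \<in> W k) \<and> finite {k. f k \<noteq> 0} \<and> w = (\<Sum>k | f k \<noteq> 0. f k)"
    if "w \<in> Q" for w
    using sum that by (simp add: direct_sum_def)
  have bij: "bij_betw vec fin_coords Q"
  proof (rule bij_betwI')
    fix x y assume xy: "x \<in> fin_coords" "y \<in> fin_coords"
    have dec: "(\<forall>k. smul (x k) (e k) \<in> W k) \<and> finite {k. smul (x k) (e k) \<noteq> 0} \<and>
        vec x = (\<Sum>k | smul (x k) (e k) \<noteq> 0. smul (x k) (e k))" if "x \<in> fin_coords" for x
      using that smul_e(1) by (simp add: smul_e_0 vec_def fin_coords_iff)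
    show "vec x = vec y \<longleftrightarrow> x = y"
    proof
      assume "vec x = vec y"
      then have "(\<lambda>k. smul (x k) (e k)) = (\<lambda>k. smul (y k) (e k))"
        using unique[OF vec_Q[OF xy(1)]] dec[OF xy(1)] dec[OF xy(2)] by metis
      then show "x = y" using smul_e(2) by (auto simp: fun_eq_iff)
    qed simp
  next
    fix w assume "w \<in> Q"
    then obtain f where f: "\<And>k. f k \<in> W k" "finite {k. f k \<noteq> 0}" "w = (\<Sum>k | f k \<noteq> 0. f k)"
      using unique by metis
    have "\<forall>k. \<exists>q. f k = smul q (e k)"
      using f(1) e(2) by (metis bij_betw_def imageE)
    then obtain x where x: "\<And>k. f k = smul (x k) (e k)" by metis
    have "x \<in> fin_coords" "w = vec x"
      using f(2,3) by (simp_all add: x smul_e_0 vec_def fin_coords_iff)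
    then show "\<exists>x\<in>fin_coords. w = vec x" by blast
  qed (rule vec_Q)
  have "coordinates_action smul Q vec n act"
  proof
    show "bij_betw vec fin_coords Q" by (rule bij)
    show "n \<ge> 1" by fact
    fix x assume x: "x \<in> fin_coords"
    let ?A = "{k. x k \<noteq> 0}"
    have A: "finite ?A" using x by (simp add: fin_coords_iff)
    show "vec (\<lambda>i. l * x i) = smul l (vec x)" for l
    proof -
      have "vec (\<lambda>i. l * x i) = (\<Sum>k\<in>?A. smul l (smul (x k) (e k)))"
        using vec[OF A, of "\<lambda>i. l * x i"] Q(6)[OF eQ] by (auto intro!: sum.cong)
      also have "\<dots> = smul l (vec x)"
        unfolding vec_def by (rule additive(2)[where h = "smul l", OF A, symmetric]) (simp_all add: Q(4))
      finally show ?thesis .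
    qed
    show "act g (vec x) = vec (\<lambda>i. x i * root_power n (int i * g))"
      if g: "g \<in> carrier (integer_mod_group n)" for g
    proof -
      have "act g (vec x) = (\<Sum>k\<in>?A. act g (smul (x k) (e k)))"
        unfolding vec_def by (rule additive(2)[where h = "act g", OF A]) (simp_all add: act(1)[OF g])
      also have "\<dots> = (\<Sum>k\<in>?A. smul (x k * root_power n (int k * g)) (e k))"
        using act(2)[OF g eQ eQ] e(3)[OF g] Q(6)[OF eQ] by (intro sum.cong) simp_all
      also have "\<dots> = vec (\<lambda>i. x i * root_power n (int i * g))"
        using vec[OF A, of "\<lambda>i. x i * root_power n (int i * g)"] by auto
      finally show ?thesis .
    qed
    fix y assume y: "y \<in> fin_coords"
    let ?B = "{k. x k \<noteq> 0} \<union> {k. y k \<noteq> 0}"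
    have B: "finite ?B" using x y by (simp add: fin_coords_iff)
    have "vec (\<lambda>i. x i + y i) = (\<Sum>k\<in>?B. smul (x k) (e k) + smul (y k) (e k))"
      by (subst vec[OF B]) (auto simp: Q(5)[OF eQ])
    then show "vec (\<lambda>i. x i + y i) = vec x + vec y"
      using vec[OF B, of x] vec[OF B, of y] by (simp add: sum.distrib)
  qed
  moreover have "vec ` coord_space k = flag_sum W k" for k
  proof (intro subset_antisym subsetI)
    fix w assume "w \<in> vec ` coord_space k"
    then obtain x where x: "x \<in> coord_space k" "w = vec x" by blast
    have "{i. x i \<noteq> 0} \<subseteq> {..<k}" using x(1) by (auto simp: coord_space_def intro: leI not_less)
    then have "w = (\<Sum>i<k. smul (x i) (e i))" using vec[of "{..<k}" x] x(2) by simp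
    then show "w \<in> flag_sum W k" using smul_e(1) by (auto simp: flag_sum_def)
  next
    fix w assume "w \<in> flag_sum W k"
    then obtain f where f: "w = (\<Sum>i<k. f i)" "\<forall>i<k. f i \<in> W i" by (auto simp: flag_sum_def)
    have "\<forall>i<k. \<exists>q. f i = smul q (e i)"
      using f(2) e(2) by (metis bij_betw_def imageE)
    then obtain q where q: "\<And>i. i < k \<Longrightarrow> f i = smul (q i) (e i)" by metis
    define x where "x i = (if i < k then q i else 0)" for i
    have "w = vec x" using f(1) q by (subst vec[of "{..<k}"]) (auto simp: x_def split: if_splits)
    moreover have "x \<in> coord_space k" by (simp add: coord_space_def x_def)
    ultimately show "w \<in> vec ` coord_space k" by blast
  qed
  ultimately show thesis using that by blast
qed

theorem theorem4p18:
  fixes n :: nat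
    and smul :: "quat \<Rightarrow> 'q::ab_group_add \<Rightarrow> 'q"
    and act :: "int \<Rightarrow> 'q \<Rightarrow> 'q"
    and Q :: "'q set"
    and W :: "nat \<Rightarrow> 'q set"
  assumes "n \<ge> 1"
    and "complete_universe n smul act Q"
    and "split_full_flag (integer_mod_group n) smul act Q W"
    and "\<And>k. iso_Psi n smul act (int k) (W k)"
  shows "(\<exists>p. topspace (proj_space smul (flag_sum W 1)) = {p}) \<and>
         properly_even_structure (integer_mod_group n)
           (proj_space smul Q) (\<lambda>g. image (act g))
           (\<lambda>m. proj_space smul (flag_sum W (Suc m)))"
proof -
  obtain vec where vec: "coordinates_action smul Q vec n act"
    and flags: "\<And>k. vec ` coord_space k = flag_sum W k"
    using flag_coordinates[OF assms(1,3,4)] by blast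
  interpret coordinates_action smul Q vec n act by (rule vec)
  have "flag_sum W k = flag k" for k using flags by (simp add: flag_def)
  then show ?thesis
    using topspace_proj_flag_1 properly_even_flag_filtration by simp
qed

end
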